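(* Assume $p(K)>0$ and let $r\in(0,r(K,\partial)]$. Then $K\{X/r\}$, regarded as a left $K\langle T\rangle$-module, is an injective object of the category of left $K\langle T\rangle$-modules.
   Context: $K$ is a field of characteristic $0$, complete for a non-trivial non-archimedean absolute value $|\cdot|$, with a non-zero bounded derivation $\partial$; $p(K)$ is the residue characteristic; $\omega(K)=|p(K)|^{1/(p(K)-1)}$ if $p(K)>0$, else $1$; $r(K,\partial)=\omega(K)/\inf_{i\ge1}|\partial^i|_{op}^{1/i}$. $K\langle T\rangle$ is the twisted polynomial ring with $Ta=aT+\partial(a)$. $K[[X]]$ is a left $K\langle T\rangle$-module via $c\cdot F=(\sum_{i\ge0}\frac{\partial^i(c)}{i!}X^i)F$ for $c\in K$ and $T\cdot F=dF/dX$. $K\{X/r\}=\{\sum a_iX^i\in K[[X]]:\sup_i|a_i|s^i<\infty\ \text{for all }0<s<r\}$; for $r\le r(K,\partial)$ it is a $K\langle T\rangle$-submodule of $K[[X]]$. *)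

theory Defs
  imports
    "HOL-Analysis.Analysis"
    "HOL-Computational_Algebra.Computational_Algebra"
    "HOL-Algebra.Module"
    "HOL-Algebra.QuotRing"
begin

section \<open>Left modules over a not necessarily commutative ring\<close>

text \<open>
  The locale \<^locale>\<open>module\<close> of the library requires a commutative ring of scalars.  The axioms
  below are the same with \<^locale>\<open>ring\<close> instead.  The record type is reused, so the
  fields \<^const>\<open>mult\<close> and \<^const>\<open>one\<close> of a module are irrelevant.
\<close>

locale left_module = R?: ring R + M?: abelian_group M
  for R :: "('a, 'c) ring_scheme" (structure) and M :: "('a, 'b, 'd) module_scheme" (structure) +
  assumes smult_closed:
      "\<lbrakk>a \<in> carrier R; x \<in> carrier M\<rbrakk> \<Longrightarrow> a \<odot>\<^bsub>M\<^esub> x \<in> carrier M"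
    and smult_l_distr:
      "\<lbrakk>a \<in> carrier R; b \<in> carrier R; x \<in> carrier M\<rbrakk> \<Longrightarrow>
        (a \<oplus>\<^bsub>R\<^esub> b) \<odot>\<^bsub>M\<^esub> x = a \<odot>\<^bsub>M\<^esub> x \<oplus>\<^bsub>M\<^esub> b \<odot>\<^bsub>M\<^esub> x"
    and smult_r_distr:
      "\<lbrakk>a \<in> carrier R; x \<in> carrier M; y \<in> carrier M\<rbrakk> \<Longrightarrow>
        a \<odot>\<^bsub>M\<^esub> (x \<oplus>\<^bsub>M\<^esub> y) = a \<odot>\<^bsub>M\<^esub> x \<oplus>\<^bsub>M\<^esub> a \<odot>\<^bsub>M\<^esub> y"
    and smult_assoc:
      "\<lbrakk>a \<in> carrier R; b \<in> carrier R; x \<in> carrier M\<rbrakk> \<Longrightarrow>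
        (a \<otimes>\<^bsub>R\<^esub> b) \<odot>\<^bsub>M\<^esub> x = a \<odot>\<^bsub>M\<^esub> (b \<odot>\<^bsub>M\<^esub> x)"
    and smult_one:
      "x \<in> carrier M \<Longrightarrow> \<one>\<^bsub>R\<^esub> \<odot>\<^bsub>M\<^esub> x = x"

definition left_module_hom ::
  "('a, 'c) ring_scheme \<Rightarrow> ('a, 'm, 'd) module_scheme \<Rightarrow> ('a, 'n, 'e) module_scheme \<Rightarrow> ('m \<Rightarrow> 'n) set"
where
  "left_module_hom R M N = {f \<in> carrier M \<rightarrow> carrier N.
     (\<forall>x\<in>carrier M. \<forall>y\<in>carrier M. f (x \<oplus>\<^bsub>M\<^esub> y) = f x \<oplus>\<^bsub>N\<^esub> f y) \<and>
     (\<forall>a\<in>carrier R. \<forall>x\<in>carrier M. f (a \<odot>\<^bsub>M\<^esub> x) = a \<odot>\<^bsub>N\<^esub> f x)}"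

text \<open>
  A formula cannot quantify over types, so the element types of the test modules \<open>M\<close> and
  \<open>N\<close> are parameters.  A theorem that leaves \<open>'m\<close> and \<open>'n\<close> as type variables covers all
  left \<open>R\<close>-modules.
\<close>

definition injective_left_module ::
  "'m itself \<Rightarrow> 'n itself \<Rightarrow> 'a ring \<Rightarrow> ('a, 'e) module \<Rightarrow> bool"
where
  "injective_left_module TYPE('m) TYPE('n) R E \<longleftrightarrow>
     left_module R E \<and>
     (\<forall>(M :: ('a, 'm) module) (N :: ('a, 'n) module). \<forall>\<iota> f.
        left_module R M \<and> left_module R N \<and>
        \<iota> \<in> left_module_hom R M N \<and> inj_on \<iota> (carrier M) \<and>
        f \<in> left_module_hom R M E \<longrightarrow>
        (\<exists>g \<in> left_module_hom R N E. \<forall>x\<in>carrier M. g (\<iota> x) = f x))"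


section \<open>Non-archimedean absolute values and derivations\<close>

definition nonarch_abs :: "('k::field \<Rightarrow> real) \<Rightarrow> bool" where
  "nonarch_abs v \<longleftrightarrow>
     (\<forall>x. 0 \<le> v x) \<and> (\<forall>x. v x = 0 \<longleftrightarrow> x = 0) \<and>
     (\<forall>x y. v (x * y) = v x * v y) \<and> (\<forall>x y. v (x + y) \<le> max (v x) (v y))"

definition nontrivial_abs :: "('k::field \<Rightarrow> real) \<Rightarrow> bool" where
  "nontrivial_abs v \<longleftrightarrow> (\<exists>x. x \<noteq> 0 \<and> v x \<noteq> 1)"

definition complete_abs :: "('k::field \<Rightarrow> real) \<Rightarrow> bool" where
  "complete_abs v \<longleftrightarrow> Metric_space.mcomplete UNIV (\<lambda>x y. v (x - y))"

definition derivation :: "('k::field \<Rightarrow> 'k) \<Rightarrow> bool" where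
  "derivation D \<longleftrightarrow>
     (\<forall>x y. D (x + y) = D x + D y) \<and> (\<forall>x y. D (x * y) = D x * y + x * D y)"

definition bounded_op :: "('k::field \<Rightarrow> real) \<Rightarrow> ('k \<Rightarrow> 'k) \<Rightarrow> bool" where
  "bounded_op v L \<longleftrightarrow> (\<exists>C. \<forall>x. v (L x) \<le> C * v x)"

definition op_norm :: "('k::field \<Rightarrow> real) \<Rightarrow> ('k \<Rightarrow> 'k) \<Rightarrow> real" where
  "op_norm v L = (SUP x\<in>{x. x \<noteq> 0}. v (L x) / v x)"

definition valuation_ring :: "('k::field \<Rightarrow> real) \<Rightarrow> 'k ring" where
  "valuation_ring v =
     \<lparr>carrier = {x. v x \<le> 1}, mult = (*), one = 1, zero = 0, add = (+)\<rparr>"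

definition residue_field :: "('k::field \<Rightarrow> real) \<Rightarrow> 'k set ring" where
  "residue_field v = valuation_ring v Quot {x. v x < 1}"

definition ring_characteristic :: "('a, 'b) ring_scheme \<Rightarrow> nat" where
  "ring_characteristic R =
     (if \<exists>n>0. add_pow R (n::nat) \<one>\<^bsub>R\<^esub> = \<zero>\<^bsub>R\<^esub>
      then LEAST n. 0 < n \<and> add_pow R n \<one>\<^bsub>R\<^esub> = \<zero>\<^bsub>R\<^esub> else 0)"

definition residue_char :: "('k::field \<Rightarrow> real) \<Rightarrow> nat" where
  "residue_char v = ring_characteristic (residue_field v)"

definition omega :: "('k::field \<Rightarrow> real) \<Rightarrow> real" where
  "omega v = (if residue_char v > 0
     then v (of_nat (residue_char v)) powr (1 / (real (residue_char v) - 1)) else 1)"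

text \<open>The value is \<open>\<infinity>\<close> if the infimum vanishes, by the conventions for division in \<^typ>\<open>ereal\<close>.\<close>

definition derivation_radius :: "('k::field \<Rightarrow> real) \<Rightarrow> ('k \<Rightarrow> 'k) \<Rightarrow> ereal" where
  "derivation_radius v D =
     ereal (omega v) / ereal (INF i\<in>{1..}. root i (op_norm v (D ^^ i)))"


section \<open>The twisted polynomial ring\<close>

text \<open>
  The polynomial with coefficients \<open>a\<^sub>i\<close> stands for \<open>\<Sum>i. a\<^sub>i T\<^sup>i\<close>, with the coefficients on the
  left.  Left multiplication by \<open>T\<close> sends \<open>\<Sum>i. a\<^sub>i T\<^sup>i\<close> to \<open>\<Sum>i. a\<^sub>i T\<^sup>i\<^sup>+\<^sup>1 + \<Sum>i. D(a\<^sub>i) T\<^sup>i\<close>.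
\<close>

definition T_mult :: "('k::field \<Rightarrow> 'k) \<Rightarrow> 'k poly \<Rightarrow> 'k poly" where
  "T_mult D Q = pCons 0 Q + map_poly D Q"

definition twisted_mult :: "('k::field \<Rightarrow> 'k) \<Rightarrow> 'k poly \<Rightarrow> 'k poly \<Rightarrow> 'k poly" where
  "twisted_mult D P Q =
     (\<Sum>i\<le>degree P. Polynomial.smult (coeff P i) ((T_mult D ^^ i) Q))"

definition twisted_poly_ring :: "('k::field \<Rightarrow> 'k) \<Rightarrow> 'k poly ring" where
  "twisted_poly_ring D =
     \<lparr>carrier = UNIV, mult = twisted_mult D, one = 1, zero = 0, add = (+)\<rparr>"


section \<open>Power series as modules over the twisted polynomial ring\<close>

definition taylor :: "('k::field_char_0 \<Rightarrow> 'k) \<Rightarrow> 'k \<Rightarrow> 'k fps" where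
  "taylor D c = Abs_fps (\<lambda>i. (D ^^ i) c / fact i)"

definition twisted_act :: "('k::field_char_0 \<Rightarrow> 'k) \<Rightarrow> 'k poly \<Rightarrow> 'k fps \<Rightarrow> 'k fps" where
  "twisted_act D P F = (\<Sum>i\<le>degree P. taylor D (coeff P i) * (fps_deriv ^^ i) F)"

definition power_series_module :: "('k::field_char_0 \<Rightarrow> 'k) \<Rightarrow> ('k poly, 'k fps) module" where
  "power_series_module D =
     \<lparr>carrier = UNIV, mult = (*), one = 1, zero = 0, add = (+), smult = twisted_act D\<rparr>"

definition convergent_series :: "('k::field_char_0 \<Rightarrow> real) \<Rightarrow> real \<Rightarrow> 'k fps set" where
  "convergent_series v r =
     {F. \<forall>s. 0 < s \<and> s < r \<longrightarrow> bdd_above (range (\<lambda>i. v (fps_nth F i) * s ^ i))}"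

definition convergent_series_module ::
  "('k::field_char_0 \<Rightarrow> real) \<Rightarrow> ('k \<Rightarrow> 'k) \<Rightarrow> real \<Rightarrow> ('k poly, 'k fps) module"
where
  "convergent_series_module v D r = (power_series_module D)\<lparr>carrier := convergent_series v r\<rparr>"


section \<open>The ring and module axioms\<close>

context
  fixes D :: "'k::field_char_0 \<Rightarrow> 'k"
  assumes D: "derivation D"
begin

lemma D_add: "D (x + y) = D x + D y" and D_mult: "D (x * y) = D x * y + x * D y"
  using D by (auto simp: derivation_def)

lemma D_0: "D 0 = 0"
  using D_add[of 0 0] by simp

lemma D_1: "D 1 = 0"
  using D_mult[of 1 1] by simp

lemma T_mult_add: "T_mult D (P + Q) = T_mult D P + T_mult D Q"
  by (rule poly_eqI) (simp add: T_mult_def coeff_map_poly D_0 D_add coeff_pCons split: nat.split)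

lemma T_mult_0: "T_mult D 0 = 0"
  by (simp add: T_mult_def)

lemma T_mult_smult:
  "T_mult D (Polynomial.smult a Q) = Polynomial.smult a (T_mult D Q) + Polynomial.smult (D a) Q"
  by (rule poly_eqI)
    (simp add: T_mult_def coeff_map_poly D_0 D_mult coeff_pCons algebra_simps split: nat.split)

lemma T_mult_pCons: "T_mult D (pCons a P) = pCons (D a) (pCons a 0 + T_mult D P)"
  by (rule poly_eqI)
    (simp add: T_mult_def coeff_map_poly D_0 coeff_pCons split: nat.split)

lemma T_mult_pow_add: "(T_mult D ^^ i) (P + Q) = (T_mult D ^^ i) P + (T_mult D ^^ i) Q"
  by (induction i) (simp_all add: T_mult_add)

lemma twisted_mult_bound:
  assumes "degree P \<le> n"
  shows "twisted_mult D P Q = (\<Sum>i\<le>n. Polynomial.smult (coeff P i) ((T_mult D ^^ i) Q))"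
  unfolding twisted_mult_def using assms
  by (intro sum.mono_neutral_left) (auto simp: coeff_eq_0)

lemma twisted_mult_add_left: "twisted_mult D (P + P') Q = twisted_mult D P Q + twisted_mult D P' Q"
proof -
  let ?n = "max (degree P) (degree P')"
  have "degree (P + P') \<le> ?n" by (rule degree_add_le_max)
  then show ?thesis
    by (simp add: twisted_mult_bound[of _ ?n] smult_add_left sum.distrib)
qed

lemma twisted_mult_add_right: "twisted_mult D P (Q + Q') = twisted_mult D P Q + twisted_mult D P Q'"
  by (simp add: twisted_mult_def T_mult_pow_add smult_add_right sum.distrib)

lemma twisted_mult_0: "twisted_mult D 0 Q = 0"
  by (simp add: twisted_mult_def)

lemma twisted_mult_pCons:
  "twisted_mult D (pCons a P) Q = Polynomial.smult a Q + twisted_mult D P (T_mult D Q)"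
proof -
  have "degree (pCons a P) \<le> Suc (degree P)" by (rule degree_pCons_le)
  then show ?thesis
    by (simp add: twisted_mult_bound[of _ "Suc (degree P)"] sum.atMost_Suc_shift twisted_mult_def
        funpow_Suc_right del: funpow.simps(2) sum.atMost_Suc)
qed

lemma twisted_mult_smult:
  "twisted_mult D (Polynomial.smult a P) Q = Polynomial.smult a (twisted_mult D P Q)"
  by (induction P arbitrary: Q) (simp_all add: twisted_mult_0 twisted_mult_pCons smult_add_right)

lemma twisted_mult_T_mult: "twisted_mult D (T_mult D P) Q = T_mult D (twisted_mult D P Q)"
proof (induction P arbitrary: Q)
  case 0
  then show ?case by (simp add: T_mult_0 twisted_mult_0)
next
  case (pCons a P)
  then show ?case
    by (simp add: T_mult_pCons twisted_mult_pCons twisted_mult_add_left twisted_mult_0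
        T_mult_add T_mult_smult algebra_simps)
qed

lemma twisted_mult_assoc:
  "twisted_mult D (twisted_mult D P Q) S = twisted_mult D P (twisted_mult D Q S)"
  by (induction P arbitrary: Q)
    (simp_all add: twisted_mult_0 twisted_mult_pCons twisted_mult_add_left twisted_mult_smult
      twisted_mult_T_mult)

lemma T_mult_monom: "T_mult D (monom 1 n) = monom 1 (Suc n)"
  by (rule poly_eqI) (simp add: T_mult_def coeff_map_poly D_0 D_1 coeff_pCons split: nat.split)

lemma twisted_mult_1_left: "twisted_mult D 1 Q = Q"
  by (simp add: twisted_mult_def)

lemma twisted_mult_1_right: "twisted_mult D P 1 = P"
proof -
  have "(T_mult D ^^ i) 1 = monom 1 i" for i
    by (induction i) (simp_all add: T_mult_monom)
  then show ?thesis
    by (simp add: twisted_mult_def smult_monom poly_as_sum_of_monoms)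
qed

text \<open>The relation \<open>T a = a T + D(a)\<close>.\<close>

lemma twisted_mult_T_const:
  "twisted_mult D [:0, 1:] [:a:] = twisted_mult D [:a:] [:0, 1:] + [:D a:]"
  by (simp add: twisted_mult_pCons twisted_mult_0 T_mult_pCons T_mult_0)

lemma ring_twisted_poly_ring: "ring (twisted_poly_ring D)"
proof (rule ringI)
  show "abelian_group (twisted_poly_ring D)"
  proof (rule abelian_groupI)
    fix x assume "x \<in> carrier (twisted_poly_ring D)"
    show "\<exists>y\<in>carrier (twisted_poly_ring D).
        y \<oplus>\<^bsub>twisted_poly_ring D\<^esub> x = \<zero>\<^bsub>twisted_poly_ring D\<^esub>"
      by (rule bexI[of _ "- x"]) (simp_all add: twisted_poly_ring_def)
  qed (simp_all add: twisted_poly_ring_def algebra_simps)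
  show "Group.monoid (twisted_poly_ring D)"
    by (rule Group.monoidI)
      (simp_all add: twisted_poly_ring_def twisted_mult_assoc twisted_mult_1_left twisted_mult_1_right)
qed (simp_all add: twisted_poly_ring_def twisted_mult_add_left twisted_mult_add_right)

lemma taylor_add: "taylor D (a + b) = taylor D a + taylor D b"
proof -
  have "(D ^^ i) (a + b) = (D ^^ i) a + (D ^^ i) b" for i
    by (induction i) (simp_all add: D_add)
  then show ?thesis by (simp add: taylor_def fps_eq_iff add_divide_distrib)
qed

lemma taylor_0: "taylor D 0 = 0"
  using taylor_add[of 0 0] by simp

lemma fps_deriv_taylor: "fps_deriv (taylor D a) = taylor D (D a)"
  by (simp add: taylor_def fps_eq_iff funpow_swap1 field_simps del: of_nat_Suc)

lemma taylor_mult: "taylor D (a * b) = taylor D a * taylor D b"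
proof -
  have "fps_nth (taylor D (a * b)) n = fps_nth (taylor D a * taylor D b) n" for n
  proof (induction n arbitrary: a b)
    case 0
    then show ?case by (simp add: taylor_def)
  next
    case (Suc n)
    have "of_nat (Suc n) * fps_nth (taylor D (a * b)) (Suc n) = fps_nth (fps_deriv (taylor D (a * b))) n"
      by simp
    also have "\<dots> = fps_nth (taylor D (D a * b) + taylor D (a * D b)) n"
      by (simp only: fps_deriv_taylor D_mult taylor_add)
    also have "\<dots> = fps_nth (taylor D (D a) * taylor D b + taylor D a * taylor D (D b)) n"
      by (simp add: Suc)
    also have "\<dots> = fps_nth (fps_deriv (taylor D a * taylor D b)) n"
      by (simp add: fps_deriv_taylor algebra_simps)
    also have "\<dots> = of_nat (Suc n) * fps_nth (taylor D a * taylor D b) (Suc n)"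
      by (simp only: fps_deriv_nth Suc_eq_plus1)
    finally show ?case by (simp del: of_nat_Suc)
  qed
  then show ?thesis by (simp add: fps_eq_iff)
qed

lemma taylor_1: "taylor D 1 = 1"
proof -
  have "(D ^^ i) 1 = (if i = 0 then 1 else 0)" for i
    by (induction i) (simp_all add: D_0 D_1)
  then show ?thesis by (simp add: taylor_def fps_eq_iff)
qed

lemma fps_deriv_pow_add:
  "(fps_deriv ^^ i) (F + G) = (fps_deriv ^^ i) F + (fps_deriv ^^ i) (G :: 'k fps)"
  by (induction i) simp_all

lemma twisted_act_bound:
  assumes "degree P \<le> n"
  shows "twisted_act D P F = (\<Sum>i\<le>n. taylor D (coeff P i) * (fps_deriv ^^ i) F)"
  unfolding twisted_act_def using assms
  by (intro sum.mono_neutral_left) (auto simp: coeff_eq_0 taylor_0)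

lemma twisted_act_add_left: "twisted_act D (P + P') F = twisted_act D P F + twisted_act D P' F"
proof -
  let ?n = "max (degree P) (degree P')"
  have "degree (P + P') \<le> ?n" by (rule degree_add_le_max)
  then show ?thesis
    by (simp add: twisted_act_bound[of _ ?n] taylor_add distrib_right sum.distrib)
qed

lemma twisted_act_add_right: "twisted_act D P (F + G) = twisted_act D P F + twisted_act D P G"
  by (simp add: twisted_act_def fps_deriv_pow_add distrib_left sum.distrib)

lemma twisted_act_0: "twisted_act D 0 F = 0"
  by (simp add: twisted_act_def taylor_0)

lemma twisted_act_pCons: "twisted_act D (pCons a P) F = taylor D a * F + twisted_act D P (fps_deriv F)"
proof -
  have "degree (pCons a P) \<le> Suc (degree P)" by (rule degree_pCons_le)
  then show ?thesis
    by (simp add: twisted_act_bound[of _ "Suc (degree P)"] sum.atMost_Suc_shift twisted_act_def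
        taylor_0 funpow_Suc_right del: funpow.simps(2) sum.atMost_Suc)
qed

lemma twisted_act_const: "twisted_act D [:c:] F = taylor D c * F"
  by (simp add: twisted_act_pCons twisted_act_0)

lemma twisted_act_T: "twisted_act D [:0, 1:] F = fps_deriv F"
  by (simp add: twisted_act_pCons twisted_act_0 taylor_0 taylor_1)

lemma twisted_act_smult: "twisted_act D (Polynomial.smult a P) F = taylor D a * twisted_act D P F"
  by (induction P arbitrary: F)
    (simp_all add: twisted_act_0 twisted_act_pCons taylor_mult distrib_left mult.assoc)

lemma twisted_act_T_mult: "twisted_act D (T_mult D P) F = fps_deriv (twisted_act D P F)"
proof (induction P arbitrary: F)
  case 0
  then show ?case by (simp add: T_mult_0 twisted_act_0)
next
  case (pCons a P)
  then show ?case
    by (simp add: T_mult_pCons twisted_act_pCons twisted_act_add_left twisted_act_0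
        fps_deriv_taylor algebra_simps)
qed

lemma twisted_act_twisted_mult: "twisted_act D (twisted_mult D P Q) F = twisted_act D P (twisted_act D Q F)"
  by (induction P arbitrary: Q)
    (simp_all add: twisted_mult_0 twisted_act_0 twisted_mult_pCons twisted_act_pCons
      twisted_act_add_left twisted_act_smult twisted_act_T_mult)

lemma left_module_power_series: "left_module (twisted_poly_ring D) (power_series_module D)"
proof (intro left_module.intro left_module_axioms.intro ring_twisted_poly_ring)
  show "abelian_group (power_series_module D)"
  proof (rule abelian_groupI)
    fix x assume "x \<in> carrier (power_series_module D)"
    show "\<exists>y\<in>carrier (power_series_module D).
        y \<oplus>\<^bsub>power_series_module D\<^esub> x = \<zero>\<^bsub>power_series_module D\<^esub>"
      by (rule bexI[of _ "- x"]) (simp_all add: power_series_module_def)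
  qed (simp_all add: power_series_module_def algebra_simps)
next
  fix x show "\<one>\<^bsub>twisted_poly_ring D\<^esub> \<odot>\<^bsub>power_series_module D\<^esub> x = x"
    using twisted_act_const[of 1 x]
    by (simp add: power_series_module_def twisted_poly_ring_def taylor_1 one_pCons)
qed (simp_all add: power_series_module_def twisted_poly_ring_def twisted_act_add_left
    twisted_act_add_right twisted_act_twisted_mult)

end

end

theory Submission
  imports Defs
begin

unbundle no vec_syntax

text \<open>
  Left ideals of \<open>A = K\<langle>T\<rangle>\<close> are principal, so by Baer's criterion it suffices that every nonzero
  \<open>L \<in> A\<close> acts surjectively on \<open>K{X/r}\<close>.  For \<open>s < r\<close> the operator norm of \<open>A\<close> on the series bounded
  for the radius \<open>s\<close> is \<open>N\<^sub>s (\<Sum> a\<^sub>i T\<^sup>i) = max \<bar>a\<^sub>i i!\<bar> s\<^sup>-\<^sup>i\<close>.  Induct on the degree of \<open>L\<close>.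

  If \<open>N\<^sub>s (1 - L Q) < 1\<close> for some \<open>s < r\<close> and \<open>Q\<close>, then the same holds for all larger radii below
  \<open>r\<close>, and \<open>f = Q (\<Sum>k. (1 - L Q)\<^sup>k g)\<close> solves \<open>L f = g\<close>.

  Otherwise the closure of the right ideal \<open>L A\<close> for \<open>N\<^sub>s\<close> is a proper right ideal \<open>M A\<close>.  Either \<open>L\<close> is a
  product of two factors of smaller degree, or \<open>L A\<close> is closed for every \<open>s < r\<close>.  In the latter case
  write \<open>T\<^sup>k \<equiv> \<Sum>j<n. T\<^sup>j \<beta>\<^sub>k\<^sub>j\<close> modulo \<open>L A\<close>, where \<open>n\<close> is the degree of \<open>L\<close>.  Closed subspaces of finite
  codimension over a complete field have bounded coordinates, hence
  \<open>\<bar>\<beta>\<^sub>k\<^sub>j\<bar> \<le> C \<bar>k!\<bar> s\<^sup>-\<^sup>k\<close>.  With \<open>a\<close> the leading coefficient of \<open>L\<close> and \<open>I\<close> the integration from \<open>0\<close>, the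
  solution with vanishing initial values is \<open>f = \<Sum>k. (\<beta>\<^sub>k\<^sub>,\<^sub>n\<^sub>-\<^sub>1 / a) I\<^sup>k\<^sup>+\<^sup>1 g\<close>.  It converges for the radius
  \<open>r\<close> because \<open>\<bar>k! m! / (m + k + 1)!\<bar>\<close> grows at most polynomially.
\<close>

section \<open>Twisted polynomials and Baer's criterion\<close>

context left_module
begin

lemma smult_zero_left: "x \<in> carrier M \<Longrightarrow> \<zero>\<^bsub>R\<^esub> \<odot>\<^bsub>M\<^esub> x = \<zero>\<^bsub>M\<^esub>"
  using smult_l_distr[of "\<zero>\<^bsub>R\<^esub>" "\<zero>\<^bsub>R\<^esub>" x] smult_closed[of "\<zero>\<^bsub>R\<^esub>" x]
  by (metis M.add.r_cancel_one' R.add.l_one R.zero_closed)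

text \<open>In Baer's criterion below this turns closure of a graph under scalars into closure under
  negatives.\<close>

lemma smult_minus_one:
  assumes "x \<in> carrier M"
  shows "(\<ominus>\<^bsub>R\<^esub> \<one>\<^bsub>R\<^esub>) \<odot>\<^bsub>M\<^esub> x = \<ominus>\<^bsub>M\<^esub> x"
proof -
  have "x \<oplus>\<^bsub>M\<^esub> (\<ominus>\<^bsub>R\<^esub> \<one>\<^bsub>R\<^esub>) \<odot>\<^bsub>M\<^esub> x = (\<one>\<^bsub>R\<^esub> \<oplus>\<^bsub>R\<^esub> \<ominus>\<^bsub>R\<^esub> \<one>\<^bsub>R\<^esub>) \<odot>\<^bsub>M\<^esub> x"
    using assms by (simp add: smult_l_distr smult_one)
  also have "\<dots> = \<zero>\<^bsub>M\<^esub>"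
    using assms by (simp add: R.r_neg smult_zero_left)
  finally show ?thesis
    using assms by (metis M.minus_equality M.add.m_comm R.add.inv_closed R.one_closed smult_closed)
qed

end

lemma left_module_hom_zero:
  assumes "left_module R M" "left_module R N" "h \<in> left_module_hom R M N"
  shows "h \<zero>\<^bsub>M\<^esub> = \<zero>\<^bsub>N\<^esub>"
proof -
  interpret M: left_module R M by fact
  interpret N: left_module R N by fact
  have "h \<zero>\<^bsub>M\<^esub> \<in> carrier N" "h (\<zero>\<^bsub>R\<^esub> \<odot>\<^bsub>M\<^esub> \<zero>\<^bsub>M\<^esub>) = \<zero>\<^bsub>R\<^esub> \<odot>\<^bsub>N\<^esub> h \<zero>\<^bsub>M\<^esub>"
    using assms(3) by (auto simp: left_module_hom_def)
  then show ?thesis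
    by (simp add: M.smult_zero_left N.smult_zero_left)
qed

text \<open>The induction step of both Euclidean divisions. The zero polynomial is a separate case
  because its degree is 0.\<close>

lemma cancel_leading_term:
  fixes P Q :: "'a::comm_ring_1 poly"
  assumes "degree Q = degree P" "lead_coeff Q = lead_coeff P"
  shows "P - Q = 0 \<or> degree (P - Q) < degree P"
proof (rule disjCI)
  assume "\<not> degree (P - Q) < degree P"
  moreover have "degree (P - Q) \<le> degree P"
    using assms by (metis degree_diff_le order_refl)
  ultimately have "degree (P - Q) = degree P" by simp
  then have "lead_coeff (P - Q) = 0"
    using assms by simp
  then show "P - Q = 0" by (simp only: leading_coeff_0_iff)
qed

section \<open>Degree, Euclidean division and one-sided ideals of the twisted polynomial
  ring\<close>

locale differential_field =
  fixes D :: "'k::field_char_0 \<Rightarrow> 'k"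
  assumes derivation: "derivation D"
begin

abbreviation twisted_times (infixl "\<star>" 70) where "P \<star> Q \<equiv> twisted_mult D P Q"
abbreviation act (infixr "\<triangleright>" 75) where "P \<triangleright> F \<equiv> twisted_act D P F"

lemmas twisted_simps =
  twisted_mult_add_left[OF derivation] twisted_mult_add_right[OF derivation]
  twisted_mult_0[OF derivation] twisted_mult_1_left[OF derivation] twisted_mult_1_right[OF derivation]

lemmas times_assoc = twisted_mult_assoc[OF derivation]

lemma times_0_right: "P \<star> 0 = 0"
  using twisted_mult_add_right[OF derivation, of P 0 0] by simp

lemma times_diff_right: "P \<star> (Q - S) = P \<star> Q - P \<star> S"
  using twisted_mult_add_right[OF derivation, of P "Q - S" S] by (simp add: algebra_simps)

lemma times_diff_left: "(P - Q) \<star> S = P \<star> S - Q \<star> S"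
  using twisted_mult_add_left[OF derivation, of "P - Q" Q S] by (simp add: algebra_simps)

lemma times_sum_left: "(\<Sum>i\<in>I. P i) \<star> Q = (\<Sum>i\<in>I. P i \<star> Q)"
  by (induction I rule: infinite_finite_induct) (simp_all add: twisted_simps)

lemma coeff_T_mult:
  "coeff (T_mult D Q) m = (if m = 0 then 0 else coeff Q (m - 1)) + D (coeff Q m)"
  by (simp add: T_mult_def coeff_map_poly D_0[OF derivation] coeff_pCons split: nat.split)

lemma coeff_T_mult_pow_eq_0: "degree Q + i < m \<Longrightarrow> coeff ((T_mult D ^^ i) Q) m = 0"
  by (induction i arbitrary: m) (simp_all add: coeff_T_mult coeff_eq_0 D_0[OF derivation])

lemma coeff_T_mult_pow_top: "coeff ((T_mult D ^^ i) Q) (degree Q + i) = lead_coeff Q"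
  by (induction i) (simp_all add: coeff_T_mult coeff_T_mult_pow_eq_0 D_0[OF derivation])

lemma coeff_twisted_mult: "coeff (P \<star> Q) m = (\<Sum>i\<le>degree P. coeff P i * coeff ((T_mult D ^^ i) Q) m)"
  by (simp add: twisted_mult_def coeff_sum)

text \<open>The terms with \<open>D\<close> that arise from moving \<open>T\<close> past a
  coefficient have lower degree, so the top coefficients multiply as for commutative
  polynomials.\<close>

lemma coeff_twisted_mult_top: "coeff (P \<star> Q) (degree P + degree Q) = lead_coeff P * lead_coeff Q"
proof -
  have "coeff (P \<star> Q) (degree P + degree Q)
      = (\<Sum>i\<in>{degree P}. coeff P i * coeff ((T_mult D ^^ i) Q) (degree P + degree Q))"
    unfolding coeff_twisted_mult
    by (rule sum.mono_neutral_right) (auto simp: coeff_T_mult_pow_eq_0)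
  then show ?thesis
    using coeff_T_mult_pow_top[of "degree P" Q] by (simp add: add.commute)
qed

lemma degree_twisted_mult:
  assumes "P \<noteq> 0" "Q \<noteq> 0"
  shows "degree (P \<star> Q) = degree P + degree Q"
proof (rule antisym)
  show "degree (P \<star> Q) \<le> degree P + degree Q"
    by (rule degree_le) (auto simp: coeff_twisted_mult coeff_T_mult_pow_eq_0)
  show "degree P + degree Q \<le> degree (P \<star> Q)"
    using assms by (intro le_degree) (simp add: coeff_twisted_mult_top)
qed

lemma lead_coeff_twisted_mult:
  "P \<noteq> 0 \<Longrightarrow> Q \<noteq> 0 \<Longrightarrow> lead_coeff (P \<star> Q) = lead_coeff P * lead_coeff Q"
  using coeff_twisted_mult_top[of P Q] by (simp add: degree_twisted_mult)

text \<open>The quotient stands on the right of \<open>B\<close>, as right ideals require. Since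
  leading coefficients multiply, subtracting \<open>B \<star> S\<close> with a suitable monomial
  \<open>S\<close> lowers the degree.\<close>

lemma right_division:
  assumes "B \<noteq> 0"
  shows "\<exists>Q. P - B \<star> Q = 0 \<or> degree (P - B \<star> Q) < degree B"
proof (induction "degree P" arbitrary: P rule: less_induct)
  case less
  show ?case
  proof (cases "P = 0 \<or> degree P < degree B")
    case True
    then show ?thesis by (intro exI[of _ 0]) (auto simp: times_0_right)
  next
    case False
    define S where "S = monom (lead_coeff P / lead_coeff B) (degree P - degree B)"
    have S: "S \<noteq> 0" "degree S = degree P - degree B" "lead_coeff S = lead_coeff P / lead_coeff B"
      using False assms by (simp_all add: S_def degree_monom_eq)
    have "degree (B \<star> S) = degree P"
      using False assms S(1,2) by (simp add: degree_twisted_mult)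
    moreover have "lead_coeff (B \<star> S) = lead_coeff P"
      using assms S(1,3) by (simp add: lead_coeff_twisted_mult)
    ultimately have "P - B \<star> S = 0 \<or> degree (P - B \<star> S) < degree P"
      by (rule cancel_leading_term)
    then show ?thesis
    proof
      assume "degree (P - B \<star> S) < degree P"
      from less[OF this] obtain Q where
        "P - B \<star> S - B \<star> Q = 0 \<or> degree (P - B \<star> S - B \<star> Q) < degree B" ..
      then show ?thesis
        by (intro exI[of _ "S + Q"]) (simp add: twisted_simps algebra_simps)
    qed auto
  qed
qed

lemma left_division:
  assumes "B \<noteq> 0"
  shows "\<exists>Q. P - Q \<star> B = 0 \<or> degree (P - Q \<star> B) < degree B"
proof (induction "degree P" arbitrary: P rule: less_induct)
  case less
  show ?case
  proof (cases "P = 0 \<or> degree P < degree B")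
    case True
    then show ?thesis by (intro exI[of _ 0]) (auto simp: twisted_simps)
  next
    case False
    define S where "S = monom (lead_coeff P / lead_coeff B) (degree P - degree B)"
    have S: "S \<noteq> 0" "degree S = degree P - degree B" "lead_coeff S = lead_coeff P / lead_coeff B"
      using False assms by (simp_all add: S_def degree_monom_eq)
    have "degree (S \<star> B) = degree P"
      using False assms S(1,2) by (simp add: degree_twisted_mult)
    moreover have "lead_coeff (S \<star> B) = lead_coeff P"
      using assms S(1,3) by (simp add: lead_coeff_twisted_mult)
    ultimately have "P - S \<star> B = 0 \<or> degree (P - S \<star> B) < degree P"
      by (rule cancel_leading_term)
    then show ?thesis
    proof
      assume "degree (P - S \<star> B) < degree P"
      from less[OF this] obtain Q where
        "P - S \<star> B - Q \<star> B = 0 \<or> degree (P - S \<star> B - Q \<star> B) < degree B" ..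
      then show ?thesis
        by (intro exI[of _ "S + Q"]) (simp add: twisted_simps algebra_simps)
    qed auto
  qed
qed

text \<open>A nonzero element of least degree generates, because division by it leaves a remainder
  in \<open>J\<close> of smaller degree. This version is applied to closures of right ideals, the
  left version to Baer's criterion.\<close>

lemma right_ideal_principal:
  assumes "0 \<in> J" and add: "\<And>P Q. P \<in> J \<Longrightarrow> Q \<in> J \<Longrightarrow> P + Q \<in> J"
    and mult: "\<And>P Q. P \<in> J \<Longrightarrow> P \<star> Q \<in> J"
  shows "\<exists>B\<in>J. \<forall>P\<in>J. \<exists>Q. P = B \<star> Q"
proof (cases "J \<subseteq> {0}")
  case True
  then show ?thesis using assms(1) by (intro bexI[of _ 0]) (auto intro!: exI[of _ 0] simp: times_0_right)
next
  case False
  then obtain B where B: "B \<in> J" "B \<noteq> 0" and min: "\<And>P. P \<in> J \<Longrightarrow> P \<noteq> 0 \<Longrightarrow> degree B \<le> degree P"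
    using ex_has_least_nat[of "\<lambda>P. P \<in> J \<and> P \<noteq> 0" _ degree] by blast
  have "\<exists>Q. P = B \<star> Q" if "P \<in> J" for P
  proof -
    obtain Q where Q: "P - B \<star> Q = 0 \<or> degree (P - B \<star> Q) < degree B"
      using right_division[OF B(2)] by blast
    have "P + B \<star> (- Q) \<in> J"
      using that B add mult by blast
    moreover have "P + B \<star> (- Q) = P - B \<star> Q"
      using times_diff_right[of B 0 Q] by (simp add: times_0_right)
    ultimately show ?thesis
      using Q min by (metis eq_iff_diff_eq_0 not_less)
  qed
  then show ?thesis using B by blast
qed

lemma left_ideal_principal:
  assumes "0 \<in> J" and add: "\<And>P Q. P \<in> J \<Longrightarrow> Q \<in> J \<Longrightarrow> P + Q \<in> J"
    and mult: "\<And>P Q. P \<in> J \<Longrightarrow> Q \<star> P \<in> J"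
  shows "\<exists>B\<in>J. \<forall>P\<in>J. \<exists>Q. P = Q \<star> B"
proof (cases "J \<subseteq> {0}")
  case True
  then show ?thesis using assms(1) by (intro bexI[of _ 0]) (auto intro!: exI[of _ 0] simp: times_0_right)
next
  case False
  then obtain B where B: "B \<in> J" "B \<noteq> 0" and min: "\<And>P. P \<in> J \<Longrightarrow> P \<noteq> 0 \<Longrightarrow> degree B \<le> degree P"
    using ex_has_least_nat[of "\<lambda>P. P \<in> J \<and> P \<noteq> 0" _ degree] by blast
  have "\<exists>Q. P = Q \<star> B" if "P \<in> J" for P
  proof -
    obtain Q where Q: "P - Q \<star> B = 0 \<or> degree (P - Q \<star> B) < degree B"
      using left_division[OF B(2)] by blast
    have "P + (- Q) \<star> B \<in> J"
      using that B add mult by blast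
    moreover have "P + (- Q) \<star> B = P - Q \<star> B"
      using times_diff_left[of 0 Q B] by (simp add: twisted_simps)
    ultimately show ?thesis
      using Q min by (metis eq_iff_diff_eq_0 not_less)
  qed
  then show ?thesis using B by blast
qed

lemma twisted_poly_ring_sel [simp]:
  "carrier (twisted_poly_ring D) = UNIV" "mult (twisted_poly_ring D) = twisted_mult D"
  "one (twisted_poly_ring D) = 1" "zero (twisted_poly_ring D) = 0" "add (twisted_poly_ring D) = (+)"
  by (simp_all add: twisted_poly_ring_def)

text \<open>Baer's criterion; since left ideals are principal, extending a homomorphism from a left
  ideal amounts to a division.\<close>

lemma injective_if_divisible:
  fixes E :: "('k poly, 'e) module"
  assumes E: "left_module (twisted_poly_ring D) E"
    and divisible: "\<And>P y. P \<noteq> 0 \<Longrightarrow> y \<in> carrier E \<Longrightarrow> \<exists>x\<in>carrier E. P \<odot>\<^bsub>E\<^esub> x = y"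
  shows "injective_left_module TYPE('m) TYPE('n) (twisted_poly_ring D) E"
  unfolding injective_left_module_def
proof (intro conjI E allI impI, elim conjE)
  let ?R = "twisted_poly_ring D"
  fix M :: "('k poly, 'm) module" and N :: "('k poly, 'n) module" and \<iota> f
  assume M: "left_module ?R M" and N: "left_module ?R N"
    and \<iota>: "\<iota> \<in> left_module_hom ?R M N" and inj: "inj_on \<iota> (carrier M)"
    and f: "f \<in> left_module_hom ?R M E"
  interpret M: left_module ?R M by fact
  interpret N: left_module ?R N by fact
  interpret E: left_module ?R E by fact
  note Ns = N.smult_closed[simplified] N.smult_l_distr[simplified] N.smult_r_distr[simplified]
    N.smult_assoc[simplified] N.smult_one[simplified] N.smult_zero_left[simplified]
  note Es = E.smult_closed[simplified] E.smult_l_distr[simplified] E.smult_r_distr[simplified]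
    E.smult_assoc[simplified] E.smult_one[simplified] E.smult_zero_left[simplified]
  \<comment> \<open>Zorn's lemma is applied to graphs of homomorphisms from submodules of
    \<open>N\<close> that extend \<open>f\<close> along \<open>\<iota>\<close>. As such a graph is
    closed under subtraction, single-valuedness reduces to the last clause.\<close>
  define S where "S = {G. G \<subseteq> carrier N \<times> carrier E \<and> (\<lambda>x. (\<iota> x, f x)) ` carrier M \<subseteq> G \<and>
     (\<forall>x y x' y'. (x, y) \<in> G \<longrightarrow> (x', y') \<in> G \<longrightarrow> (x \<oplus>\<^bsub>N\<^esub> x', y \<oplus>\<^bsub>E\<^esub> y') \<in> G) \<and>
     (\<forall>P x y. (x, y) \<in> G \<longrightarrow> (P \<odot>\<^bsub>N\<^esub> x, P \<odot>\<^bsub>E\<^esub> y) \<in> G) \<and>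
     (\<forall>y. (\<zero>\<^bsub>N\<^esub>, y) \<in> G \<longrightarrow> y = \<zero>\<^bsub>E\<^esub>)}"
  have \<iota>0: "\<iota> \<zero>\<^bsub>M\<^esub> = \<zero>\<^bsub>N\<^esub>" and f0: "f \<zero>\<^bsub>M\<^esub> = \<zero>\<^bsub>E\<^esub>"
    by (rule left_module_hom_zero[OF M N \<iota>], rule left_module_hom_zero[OF M E f])
  let ?G0 = "(\<lambda>x. (\<iota> x, f x)) ` carrier M"
  have "?G0 \<in> S"
  proof -
    have "y = \<zero>\<^bsub>E\<^esub>" if "(\<zero>\<^bsub>N\<^esub>, y) \<in> ?G0" for y
    proof -
      from that obtain x where "x \<in> carrier M" "\<iota> x = \<iota> \<zero>\<^bsub>M\<^esub>" "y = f x" using \<iota>0 by auto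
      then show ?thesis using inj f0 by (auto dest: inj_onD)
    qed
    moreover have "(\<iota> x \<oplus>\<^bsub>N\<^esub> \<iota> x', f x \<oplus>\<^bsub>E\<^esub> f x') \<in> ?G0" if "x \<in> carrier M" "x' \<in> carrier M" for x x'
      using that \<iota> f by (intro image_eqI[of _ _ "x \<oplus>\<^bsub>M\<^esub> x'"]) (auto simp: left_module_hom_def)
    moreover have "(P \<odot>\<^bsub>N\<^esub> \<iota> x, P \<odot>\<^bsub>E\<^esub> f x) \<in> ?G0" if "x \<in> carrier M" for x P
      using that \<iota> f M.smult_closed[of P x]
      by (intro image_eqI[of _ _ "P \<odot>\<^bsub>M\<^esub> x"]) (auto simp: left_module_hom_def)
    moreover have "?G0 \<subseteq> carrier N \<times> carrier E"
      using \<iota> f by (auto simp: left_module_hom_def)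
    ultimately show ?thesis
      unfolding S_def by blast
  qed
  then have "S \<noteq> {}" by blast
  moreover have "\<Union> C \<in> S" if "C \<noteq> {}" "subset.chain S C" for C
  proof -
    have C: "G \<in> C \<Longrightarrow> G \<in> S" for G
      using that(2) by (auto simp: subset.chain_def)
    have C2: "\<exists>G\<in>C. p \<in> G \<and> q \<in> G" if "p \<in> \<Union> C" "q \<in> \<Union> C" for p q
    proof -
      from that obtain X Y where "X \<in> C" "p \<in> X" "Y \<in> C" "q \<in> Y" by blast
      moreover from this have "X \<subseteq> Y \<or> Y \<subseteq> X"
        using \<open>subset.chain S C\<close> by (simp add: subset_chain_def)
      ultimately show ?thesis by blast
    qed
    have "(x \<oplus>\<^bsub>N\<^esub> x', y \<oplus>\<^bsub>E\<^esub> y') \<in> \<Union> C" if xy: "(x, y) \<in> \<Union> C" "(x', y') \<in> \<Union> C" for x y x' y'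
    proof -
      from C2[OF xy] obtain G where "G \<in> C" "(x, y) \<in> G" "(x', y') \<in> G" by blast
      then show ?thesis using C[of G] unfolding S_def by blast
    qed
    moreover have "?G0 \<subseteq> \<Union> C" using that(1) C unfolding S_def by blast
    moreover have "\<Union> C \<subseteq> carrier N \<times> carrier E" using C unfolding S_def by blast
    moreover have "(P \<odot>\<^bsub>N\<^esub> x, P \<odot>\<^bsub>E\<^esub> y) \<in> \<Union> C" if "(x, y) \<in> \<Union> C" for P x y
      using C that unfolding S_def by blast
    moreover have "y = \<zero>\<^bsub>E\<^esub>" if "(\<zero>\<^bsub>N\<^esub>, y) \<in> \<Union> C" for y
      using C that unfolding S_def by blast
    ultimately show ?thesis
      unfolding S_def by (intro CollectI conjI allI impI)
  qed
  ultimately obtain G where "G \<in> S" and max: "\<And>X. X \<in> S \<Longrightarrow> G \<subseteq> X \<Longrightarrow> X = G"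
    using subset_Zorn_nonempty[of S] by blast
  then have GNE: "\<And>x y. (x, y) \<in> G \<Longrightarrow> x \<in> carrier N \<and> y \<in> carrier E"
    and G0: "?G0 \<subseteq> G"
    and Gadd: "\<And>x y x' y'. (x, y) \<in> G \<Longrightarrow> (x', y') \<in> G \<Longrightarrow> (x \<oplus>\<^bsub>N\<^esub> x', y \<oplus>\<^bsub>E\<^esub> y') \<in> G"
    and Gsm: "\<And>P x y. (x, y) \<in> G \<Longrightarrow> (P \<odot>\<^bsub>N\<^esub> x, P \<odot>\<^bsub>E\<^esub> y) \<in> G"
    and Gz: "\<And>y. (\<zero>\<^bsub>N\<^esub>, y) \<in> G \<Longrightarrow> y = \<zero>\<^bsub>E\<^esub>"
    unfolding S_def by blast+
  have G00: "(\<zero>\<^bsub>N\<^esub>, \<zero>\<^bsub>E\<^esub>) \<in> G"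
    using G0 \<iota>0 f0 M.zero_closed by force
  have Gfun: "y = y'" if "(x, y) \<in> G" "(x, y') \<in> G" for x y y'
  proof -
    have "(x \<oplus>\<^bsub>N\<^esub> (\<ominus>\<^bsub>?R\<^esub> \<one>\<^bsub>?R\<^esub>) \<odot>\<^bsub>N\<^esub> x, y \<oplus>\<^bsub>E\<^esub> (\<ominus>\<^bsub>?R\<^esub> \<one>\<^bsub>?R\<^esub>) \<odot>\<^bsub>E\<^esub> y') \<in> G"
      using that Gadd Gsm by blast
    then have "y \<oplus>\<^bsub>E\<^esub> \<ominus>\<^bsub>E\<^esub> y' = \<zero>\<^bsub>E\<^esub>"
      using GNE[OF that(1)] GNE[OF that(2)] Gz
      by (simp only: N.smult_minus_one E.smult_minus_one N.r_neg)
    then show ?thesis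
      using GNE[OF that(1)] GNE[OF that(2)] by (metis E.minus_equality E.minus_minus E.a_inv_closed)
  qed
  have total: "\<exists>y. (n, y) \<in> G" if n: "n \<in> carrier N" for n
  proof -
    \<comment> \<open>The left ideal of those \<open>P\<close> for which \<open>P n\<close> already
      lies in the domain of the maximal graph.\<close>
    define J where "J = {P. \<exists>y. (P \<odot>\<^bsub>N\<^esub> n, y) \<in> G}"
    have "0 \<in> J" unfolding J_def using G00 n by (auto simp: Ns)
    moreover have "P + Q \<in> J" if "P \<in> J" "Q \<in> J" for P Q
      using that Gadd n unfolding J_def by (auto simp: Ns) blast
    moreover have "Q \<star> P \<in> J" if "P \<in> J" for P Q
      using that Gsm n unfolding J_def by (auto simp: Ns)
    ultimately obtain B where B: "B \<in> J" and JB: "\<And>P. P \<in> J \<Longrightarrow> \<exists>Q. P = Q \<star> B"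
      using left_ideal_principal[of J] by blast
    from B obtain z where z: "(B \<odot>\<^bsub>N\<^esub> n, z) \<in> G" unfolding J_def by blast
    \<comment> \<open>The value \<open>y\<close> for \<open>n\<close> must satisfy
      \<open>B y = z\<close>, which divisibility provides. If \<open>B = 0\<close>, only
      \<open>P = 0\<close> puts \<open>P n\<close> into the domain, and any value would do.\<close>
    obtain y where y: "y \<in> carrier E" "B \<odot>\<^bsub>E\<^esub> y = z"
    proof (cases "B = 0")
      case True
      then have "z = \<zero>\<^bsub>E\<^esub>" using z n Gz by (simp add: Ns)
      then show ?thesis using True that[of "\<zero>\<^bsub>E\<^esub>"] by (simp add: Es)
    next
      case False
      then show ?thesis using divisible GNE[OF z] that by blast
    qed
    define G' where "G' = {(x \<oplus>\<^bsub>N\<^esub> P \<odot>\<^bsub>N\<^esub> n, w \<oplus>\<^bsub>E\<^esub> P \<odot>\<^bsub>E\<^esub> y) | x w P. (x, w) \<in> G}"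
    have G'I: "(x \<oplus>\<^bsub>N\<^esub> P \<odot>\<^bsub>N\<^esub> n, w \<oplus>\<^bsub>E\<^esub> P \<odot>\<^bsub>E\<^esub> y) \<in> G'" if "(x, w) \<in> G" for x w P
      using that unfolding G'_def by blast
    have "G \<subseteq> G'"
    proof (rule subrelI)
      fix x w assume "(x, w) \<in> G"
      then show "(x, w) \<in> G'" using G'I[of x w 0] GNE[of x w] n y by (simp add: Ns Es)
    qed
    moreover have "G' \<in> S"
      unfolding S_def
    proof (intro CollectI conjI allI impI)
      show "G' \<subseteq> carrier N \<times> carrier E"
        unfolding G'_def using GNE n y by (auto simp: Ns Es)
      show "?G0 \<subseteq> G'" using G0 \<open>G \<subseteq> G'\<close> by blast
    next
      fix a b a' b' assume "(a, b) \<in> G'" "(a', b') \<in> G'"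
      then obtain x w P x' w' P' where G: "(x, w) \<in> G" "(x', w') \<in> G" and eq:
        "a = x \<oplus>\<^bsub>N\<^esub> P \<odot>\<^bsub>N\<^esub> n" "b = w \<oplus>\<^bsub>E\<^esub> P \<odot>\<^bsub>E\<^esub> y"
        "a' = x' \<oplus>\<^bsub>N\<^esub> P' \<odot>\<^bsub>N\<^esub> n" "b' = w' \<oplus>\<^bsub>E\<^esub> P' \<odot>\<^bsub>E\<^esub> y"
        unfolding G'_def by blast
      have "a \<oplus>\<^bsub>N\<^esub> a' = (x \<oplus>\<^bsub>N\<^esub> x') \<oplus>\<^bsub>N\<^esub> (P + P') \<odot>\<^bsub>N\<^esub> n"
        "b \<oplus>\<^bsub>E\<^esub> b' = (w \<oplus>\<^bsub>E\<^esub> w') \<oplus>\<^bsub>E\<^esub> (P + P') \<odot>\<^bsub>E\<^esub> y"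
        using GNE[OF G(1)] GNE[OF G(2)] n y by (simp_all add: eq Ns Es N.a_ac E.a_ac)
      then show "(a \<oplus>\<^bsub>N\<^esub> a', b \<oplus>\<^bsub>E\<^esub> b') \<in> G'"
        using G'I[OF Gadd[OF G]] by simp
    next
      fix Q a b assume "(a, b) \<in> G'"
      then obtain x w P where G: "(x, w) \<in> G" and eq:
        "a = x \<oplus>\<^bsub>N\<^esub> P \<odot>\<^bsub>N\<^esub> n" "b = w \<oplus>\<^bsub>E\<^esub> P \<odot>\<^bsub>E\<^esub> y"
        unfolding G'_def by blast
      have "Q \<odot>\<^bsub>N\<^esub> a = Q \<odot>\<^bsub>N\<^esub> x \<oplus>\<^bsub>N\<^esub> (Q \<star> P) \<odot>\<^bsub>N\<^esub> n" "Q \<odot>\<^bsub>E\<^esub> b = Q \<odot>\<^bsub>E\<^esub> w \<oplus>\<^bsub>E\<^esub> (Q \<star> P) \<odot>\<^bsub>E\<^esub> y"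
        using GNE[OF G] n y by (simp_all add: eq Ns Es)
      then show "(Q \<odot>\<^bsub>N\<^esub> a, Q \<odot>\<^bsub>E\<^esub> b) \<in> G'"
        using G'I[OF Gsm[OF G]] by simp
    next
      fix b assume "(\<zero>\<^bsub>N\<^esub>, b) \<in> G'"
      then obtain x w P where G: "(x, w) \<in> G" and eq:
        "\<zero>\<^bsub>N\<^esub> = x \<oplus>\<^bsub>N\<^esub> P \<odot>\<^bsub>N\<^esub> n" "b = w \<oplus>\<^bsub>E\<^esub> P \<odot>\<^bsub>E\<^esub> y"
        unfolding G'_def by blast
      \<comment> \<open>The relation puts \<open>P\<close> into \<open>J\<close>, so
        \<open>P\<close> is a left multiple of \<open>B\<close>. By the choice of \<open>y\<close>
        the graph then assigns \<open>P y\<close> to \<open>P n\<close>, but also the negative of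
        \<open>w\<close>.\<close>
      note xw = GNE[OF G]
      have "P \<odot>\<^bsub>N\<^esub> n = \<ominus>\<^bsub>N\<^esub> x"
        using eq(1) xw n by (metis N.minus_equality N.a_comm Ns(1))
      then have "(P \<odot>\<^bsub>N\<^esub> n, (\<ominus>\<^bsub>?R\<^esub> \<one>\<^bsub>?R\<^esub>) \<odot>\<^bsub>E\<^esub> w) \<in> G"
        using Gsm[OF G, of "\<ominus>\<^bsub>?R\<^esub> \<one>\<^bsub>?R\<^esub>"] N.smult_minus_one xw by auto
      then have Pn: "(P \<odot>\<^bsub>N\<^esub> n, \<ominus>\<^bsub>E\<^esub> w) \<in> G"
        using E.smult_minus_one[of w] xw by simp
      then have "P \<in> J" unfolding J_def by blast
      then obtain Q where Q: "P = Q \<star> B" using JB by blast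
      have "(P \<odot>\<^bsub>N\<^esub> n, P \<odot>\<^bsub>E\<^esub> y) \<in> G"
        using Gsm[OF z, of Q] n y by (simp add: Q Ns Es)
      then have "P \<odot>\<^bsub>E\<^esub> y = \<ominus>\<^bsub>E\<^esub> w" using Gfun Pn by blast
      then show "b = \<zero>\<^bsub>E\<^esub>" using eq(2) xw by (simp add: E.r_neg)
    qed
    ultimately have "G' = G" using max by blast
    moreover have "(n, y) \<in> G'"
      using G'I[OF G00, of 1] n y by (simp add: Ns Es)
    ultimately show ?thesis by blast
  qed
  define g where "g x = (THE y. (x, y) \<in> G)" for x
  have gG: "g x = y" if "(x, y) \<in> G" for x y
    unfolding g_def using that Gfun by blast
  have Gg: "(x, g x) \<in> G" if "x \<in> carrier N" for x
    using total[OF that] gG by auto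
  have "g \<in> left_module_hom ?R N E"
    unfolding left_module_hom_def using GNE[OF Gg] gG[OF Gadd[OF Gg Gg]] gG[OF Gsm[OF Gg]] by auto
  moreover have "g (\<iota> x) = f x" if "x \<in> carrier M" for x
    using that G0 gG by blast
  ultimately show "\<exists>g\<in>left_module_hom ?R N E. \<forall>x\<in>carrier M. g (\<iota> x) = f x" by blast
qed

end

section \<open>Absolute values of integers and factorials\<close>

locale nonarch_field =
  fixes v :: "'k::field_char_0 \<Rightarrow> real"
  assumes nonarch: "nonarch_abs v"
begin

lemma v_nonneg [simp]: "0 \<le> v x" and v_eq_0_iff [simp]: "v x = 0 \<longleftrightarrow> x = 0"
  and v_mult: "v (x * y) = v x * v y" and v_add_max: "v (x + y) \<le> max (v x) (v y)"
  using nonarch by (auto simp: nonarch_abs_def)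

lemma v_0 [simp]: "v 0 = 0"
  by simp

lemma v_1 [simp]: "v 1 = 1"
proof -
  have "v 1 * v 1 = v 1 * 1" using v_mult[of 1 1] by simp
  then show ?thesis by (simp only: mult_cancel_left) simp
qed

lemma v_pos: "x \<noteq> 0 \<Longrightarrow> 0 < v x"
  using v_nonneg[of x] v_eq_0_iff[of x] by linarith

lemma v_minus [simp]: "v (- x) = v x"
proof -
  have "v (- 1) ^ 2 = 1 ^ 2" using v_mult[of "- 1" "- 1"] by (simp add: power2_eq_square)
  then have "v (- 1) = 1" using v_nonneg[of "- 1"] by (simp only: power2_eq_iff) linarith
  then show ?thesis using v_mult[of "- 1" x] by simp
qed

lemma v_diff_max: "v (x - y) \<le> max (v x) (v y)"
  using v_add_max[of x "- y"] by simp

lemma v_triangle: "v (x + y) \<le> v x + v y"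
  by (rule order_trans[OF v_add_max]) simp

lemma v_divide: "v (x / y) = v x / v y"
proof (cases "y = 0")
  case False
  then have "v (x / y) * v y = v x" by (simp flip: v_mult)
  then show ?thesis using False by (simp add: field_simps)
qed simp

lemma v_sum_le: "0 \<le> B \<Longrightarrow> (\<And>i. i \<in> I \<Longrightarrow> v (f i) \<le> B) \<Longrightarrow> v (sum f I) \<le> B"
proof (induction I rule: infinite_finite_induct)
  case (insert i I)
  have "v (f i + sum f I) \<le> max (v (f i)) (v (sum f I))" by (rule v_add_max)
  also have "\<dots> \<le> B" using insert by auto
  finally show ?case using insert by simp
qed simp_all

lemma v_sum_less: "0 < B \<Longrightarrow> (\<And>i. i \<in> I \<Longrightarrow> v (f i) < B) \<Longrightarrow> v (sum f I) < B"
proof (induction I rule: infinite_finite_induct)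
  case (insert i I)
  have "v (f i + sum f I) \<le> max (v (f i)) (v (sum f I))" by (rule v_add_max)
  also have "\<dots> < B" using insert by auto
  finally show ?case using insert by simp
qed simp_all

text \<open>Apply the strong triangle inequality to \<open>x = (x + y) - y\<close>.\<close>

lemma v_add_eq_left: "v y < v x \<Longrightarrow> v (x + y) = v x"
  using v_add_max[of x y] v_diff_max[of "x + y" y] by (simp add: max_def split: if_splits)

lemma v_of_nat_le_1: "v (of_nat n) \<le> 1"
proof (induction n)
  case (Suc n)
  then show ?case using v_add_max[of 1 "of_nat n"] by (auto simp: max_def split: if_splits)
qed simp

text \<open>The two sets are the residue classes of \<open>n\<close> and of zero. This reads the
  residue characteristic off the absolute values of integers.\<close>

lemma v_less_1_coset_eq: "{y. v (y - of_nat n) < 1} = {y. v y < 1} \<longleftrightarrow> v (of_nat n) < 1"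
proof
  assume "{y. v (y - of_nat n) < 1} = {y. v y < 1}"
  moreover have "of_nat n \<in> {y. v (y - of_nat n) < 1}" by simp
  ultimately show "v (of_nat n) < 1" by blast
next
  assume n: "v (of_nat n) < 1"
  have "v (y - of_nat n) < 1" if "v y < 1" for y
    using v_diff_max[of y "of_nat n"] n that by simp
  moreover have "v y < 1" if "v (y - of_nat n) < 1" for y
    using v_add_max[of "y - of_nat n" "of_nat n"] n that by simp
  ultimately show "{y. v (y - of_nat n) < 1} = {y. v y < 1}" by blast
qed

lemma residue_field_add_pow_one:
  "add_pow (residue_field v) (n::nat) \<one>\<^bsub>residue_field v\<^esub> = {y. v (y - of_nat n) < 1}"
proof (induction n)
  case 0
  show ?case by (simp add: add_pow_def nat_pow_def residue_field_def FactRing_def)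
next
  case (Suc n)
  have one: "\<one>\<^bsub>residue_field v\<^esub> = {y. v (y - 1) < 1}"
  proof -
    have "\<exists>h. v h < 1 \<and> y = h + 1" if "v (y - 1) < 1" for y
      using that by (intro exI[of _ "y - 1"]) simp
    then show ?thesis
      by (auto simp: residue_field_def FactRing_def a_r_coset_def r_coset_def valuation_ring_def)
  qed
  have "add_pow (residue_field v) (Suc n) \<one>\<^bsub>residue_field v\<^esub> =
      {y. v (y - of_nat n) < 1} <+>\<^bsub>valuation_ring v\<^esub> {y. v (y - 1) < 1}"
    using Suc.IH by (simp add: add_pow_def nat_pow_def one) (simp add: residue_field_def FactRing_def)
  also have "\<dots> = {y. v (y - of_nat (Suc n)) < 1}" (is "?L = ?Q")
  proof
    have "v (a + b - of_nat (Suc n)) < 1" if "v (a - of_nat n) < 1" "v (b - 1) < 1" for a b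
      using v_add_max[of "a - of_nat n" "b - 1"] that by (simp add: algebra_simps)
    then show "?L \<subseteq> ?Q"
      by (auto simp: set_add_def set_mult_def valuation_ring_def simp del: of_nat_Suc)
    have "\<exists>a b. v (a - of_nat n) < 1 \<and> v (b - 1) < 1 \<and> y = a + b" if "v (y - of_nat (Suc n)) < 1" for y
      using that by (intro exI[of _ "y - 1"] exI[of _ 1]) (simp add: algebra_simps)
    then show "?Q \<subseteq> ?L"
      by (fastforce simp: set_add_def set_mult_def valuation_ring_def simp del: of_nat_Suc)
  qed
  finally show ?case .
qed

end

locale mixed_char_field = nonarch_field v for v :: "'k::field_char_0 \<Rightarrow> real" +
  assumes residue_char_pos: "residue_char v > 0"
begin

abbreviation p :: nat where "p \<equiv> residue_char v"
abbreviation \<omega> :: real where "\<omega> \<equiv> omega v"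

lemma v_p_less_1: "v (of_nat p) < 1"
  and v_of_nat_below_p: "0 < n \<Longrightarrow> n < p \<Longrightarrow> v (of_nat n) = 1"
proof -
  let ?P = "\<lambda>n. 0 < n \<and> v (of_nat n) < 1"
  have zero: "\<zero>\<^bsub>residue_field v\<^esub> = {y. v y < 1}"
    by (simp add: residue_field_def FactRing_def)
  have p: "p = (if \<exists>n. ?P n then LEAST n. ?P n else 0)"
    unfolding residue_char_def ring_characteristic_def residue_field_add_pow_one zero
      v_less_1_coset_eq by (rule refl)
  then have ex: "\<exists>n. ?P n"
    using residue_char_pos by (auto split: if_splits)
  then have p': "p = (LEAST n. ?P n)" using p by simp
  show "v (of_nat p) < 1"
    unfolding p' using LeastI_ex[OF ex] by blast
  show "v (of_nat n) = 1" if "0 < n" "n < p"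
    using that not_less_Least[of n ?P] v_of_nat_le_1[of n] unfolding p' by fastforce
qed

lemma p_ge_2: "2 \<le> p"
  using residue_char_pos v_p_less_1 by (cases "p = 1") auto

lemma v_p_pos: "0 < v (of_nat p)"
  using residue_char_pos by (intro v_pos) simp

text \<open>Split \<open>m\<close> into \<open>m mod p\<close>, of absolute value one, and a
  multiple of \<open>p\<close>, of smaller absolute value.\<close>

lemma v_of_nat_not_dvd:
  assumes "\<not> p dvd m"
  shows "v (of_nat m) = 1"
proof -
  have "v (of_nat (m mod p)) = 1"
    using assms residue_char_pos by (intro v_of_nat_below_p) (auto simp: dvd_eq_mod_eq_0)
  moreover have "v (of_nat (p * (m div p))) < 1"
    using v_p_less_1 v_of_nat_le_1[of "m div p"] mult_left_mono[of "v (of_nat (m div p))" 1 "v (of_nat p)"]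
    by (simp add: v_mult)
  ultimately have "v (of_nat (m mod p) + of_nat (p * (m div p))) = 1"
    using v_add_eq_left by metis
  then show ?thesis
    by (simp only: flip: of_nat_add) simp
qed

text \<open>Among the factors of \<open>n!\<close> only the multiples of \<open>p\<close> matter,
  and these are \<open>p\<close> times the numbers from 1 to \<open>n div p\<close>.\<close>

lemma v_fact_div: "v (fact n) = v (of_nat p) ^ (n div p) * v (fact (n div p))"
proof (induction n)
  case (Suc n)
  show ?case
  proof (cases "p dvd Suc n")
    case True
    then have q: "Suc n div p = Suc (n div p)" by (simp add: div_Suc mod_eq_0_iff_dvd)
    then have "of_nat (Suc n) = (of_nat (p * Suc (n div p)) :: 'k)"
      using True by (metis dvd_mult_div_cancel)
    then have "v (of_nat (Suc n)) = v (of_nat p) * v (of_nat (Suc (n div p)))"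
      by (simp only: of_nat_mult v_mult)
    then show ?thesis
      using Suc.IH q by (simp add: v_mult del: of_nat_Suc)
  next
    case False
    then have "Suc n div p = n div p" by (simp add: div_Suc mod_eq_0_iff_dvd)
    then show ?thesis
      using Suc.IH v_of_nat_not_dvd[OF False] by (simp add: v_mult del: of_nat_Suc)
  qed
qed simp

lemma omega_power: "\<omega> ^ (p - 1) = v (of_nat p)"
proof -
  have "\<omega> ^ (p - 1) = \<omega> powr real (p - 1)"
    using residue_char_pos v_p_pos by (subst powr_realpow) (simp_all add: omega_def)
  also have "real (p - 1) = real p - 1" using p_ge_2 by simp
  finally show ?thesis
    using residue_char_pos p_ge_2 v_p_pos by (simp add: omega_def powr_powr)
qed

lemma omega_pos: "0 < \<omega>" and omega_le_1: "\<omega> \<le> 1"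
proof -
  show "0 < \<omega>" using residue_char_pos v_p_pos by (simp add: omega_def)
  show "\<omega> \<le> 1"
  proof (rule ccontr)
    assume "\<not> \<omega> \<le> 1"
    then have "1 \<le> \<omega> ^ (p - 1)" by (intro one_le_power) simp
    then show False using omega_power v_p_less_1 by simp
  qed
qed

text \<open>As \<open>\<omega> ^ (p - 1)\<close> is the absolute value of \<open>p\<close>,
  induction through \<open>v_fact_div\<close> gives the exponent
  \<open>(p - 1) * q + q = p * q \<le> n\<close>, where \<open>q = n div p\<close>.\<close>

lemma v_fact_ge: "\<omega> ^ n \<le> v (fact n)"
proof (induction n rule: less_induct)
  case (less n)
  show ?case
  proof (cases "n = 0")
    case False
    let ?q = "n div p"
    have "?q < n" using False p_ge_2 by simp
    have "\<omega> ^ n \<le> \<omega> ^ (p * ?q)"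
      using omega_pos omega_le_1 by (intro power_decreasing) auto
    also have "p * ?q = (p - 1) * ?q + ?q" using p_ge_2 by (simp add: algebra_simps)
    also have "\<omega> ^ \<dots> = v (of_nat p) ^ ?q * \<omega> ^ ?q"
      by (simp only: power_add power_mult omega_power)
    also have "\<dots> \<le> v (of_nat p) ^ ?q * v (fact ?q)"
      using less[OF \<open>?q < n\<close>] by (intro mult_left_mono) simp_all
    finally show ?thesis using v_fact_div[of n] by simp
  qed simp
qed

text \<open>Choose \<open>\<kappa>\<close> so that \<open>p\<close> itself satisfies the inequality,
  then remove factors \<open>p\<close> one at a time. So \<open>1 / v (of_nat i)\<close> grows at
  most polynomially.\<close>

lemma v_of_nat_ge: "\<exists>\<kappa>. \<forall>i\<ge>1. 1 \<le> v (of_nat i) * real i ^ \<kappa>"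
proof -
  obtain \<kappa> where "1 / v (of_nat p) < 2 ^ \<kappa>" using real_arch_pow[of 2] by auto
  also have "(2::real) ^ \<kappa> \<le> real p ^ \<kappa>" using p_ge_2 by (intro power_mono) auto
  finally have \<kappa>: "1 \<le> v (of_nat p) * real p ^ \<kappa>" using v_p_pos by (simp add: field_simps)
  have "1 \<le> v (of_nat i) * real i ^ \<kappa>" if "i \<ge> 1" for i
    using that
  proof (induction i rule: less_induct)
    case (less i)
    show ?case
    proof (cases "p dvd i")
      case True
      then obtain j where j: "i = p * j" by blast
      with less.prems p_ge_2 have "j < i" "1 \<le> j" by auto
      have "1 * 1 \<le> (v (of_nat p) * real p ^ \<kappa>) * (v (of_nat j) * real j ^ \<kappa>)"
        using \<kappa> less.IH[OF \<open>j < i\<close> \<open>1 \<le> j\<close>] by (intro mult_mono) auto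
      also have "\<dots> = v (of_nat i) * real i ^ \<kappa>"
        by (simp add: j v_mult power_mult_distrib mult_ac)
      finally show ?thesis by simp
    next
      case False
      then show ?thesis using v_of_nat_not_dvd[OF False] less.prems by simp
    qed
  qed
  then show ?thesis by blast
qed

text \<open>The numbers \<open>k! m! / (m + k + 1)!\<close> form Leibniz' harmonic triangle, so they are integral
  combinations of \<open>1 / i\<close> for \<open>1 \<le> i \<le> m + k + 1\<close>.\<close>

lemma v_harmonic_triangle:
  "\<exists>\<kappa>. \<forall>k m. v (fact k * fact m / fact (m + k + 1)) \<le> real (m + k + 1) ^ \<kappa>"
proof -
  obtain \<kappa> where \<kappa>: "\<And>i. i \<ge> 1 \<Longrightarrow> 1 \<le> v (of_nat i) * real i ^ \<kappa>"
    using v_of_nat_ge by blast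
  \<comment> \<open>A fixed \<open>N\<close> bounds the index sums, because the recursion below
    relates two rows of the triangle.\<close>
  have "v (fact k * fact m / fact (m + k + 1)) \<le> real N ^ \<kappa>" if "m + k + 1 \<le> N" for k m N
    using that
  proof (induction k arbitrary: m)
    case 0
    have "v (fact 0 * fact m / fact (m + 0 + 1)) = 1 / v (of_nat (m + 1))"
      by (simp add: v_divide v_mult del: of_nat_Suc)
    also have "\<dots> \<le> real (m + 1) ^ \<kappa>"
      using \<kappa>[of "m + 1"] v_pos[of "of_nat (m + 1)"]
      by (simp add: field_simps del: of_nat_Suc of_nat_add)
    also have "\<dots> \<le> real N ^ \<kappa>" using 0 by (intro power_mono) auto
    finally show ?case .
  next
    case (Suc k)
    \<comment> \<open>Writing the factor \<open>k + 1\<close> as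
      \<open>(m + k + 2) - (m + 1)\<close> gives the difference rule of the triangle.\<close>
    have "(fact (Suc k) * fact m / fact (m + Suc k + 1) :: 'k) =
        (of_nat (m + k + 2) - of_nat (m + 1)) * (fact k * fact m) / fact (m + k + 2)"
      by simp
    also have "\<dots> = fact k * fact m / fact (m + k + 1) - fact k * fact (m + 1) / fact (m + 1 + k + 1)"
    proof -
      have "(fact (m + k + 2) :: 'k) = of_nat (m + k + 2) * fact (m + k + 1)"
        using fact_Suc[of "m + k + 1", where 'a = 'k] by (simp del: fact_Suc)
      moreover have "(fact (m + 1) :: 'k) = of_nat (m + 1) * fact m"
        using fact_Suc[of m, where 'a = 'k] by (simp del: fact_Suc)
      moreover have "(of_nat (m + k + 2) :: 'k) \<noteq> 0"
        unfolding of_nat_eq_0_iff by simp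
      moreover have "m + 1 + k + 1 = m + k + 2" by simp
      moreover have "(a - b) * (c * d) / (a * e) = c * d / e - c * (b * d) / (a * e)"
        if "a \<noteq> 0" "e \<noteq> 0" for a b c d e :: 'k
        using that by (simp add: field_simps)
      ultimately show ?thesis
        by (simp only: fact_nonzero not_False_eq_True)
    qed
    finally have "v (fact (Suc k) * fact m / fact (m + Suc k + 1)) \<le>
        max (v (fact k * fact m / fact (m + k + 1))) (v (fact k * fact (m + 1) / fact (m + 1 + k + 1)))"
      by (simp only: v_diff_max)
    also have "\<dots> \<le> real N ^ \<kappa>"
      using Suc.IH[of m] Suc.IH[of "m + 1"] Suc.prems by simp
    finally show ?case .
  qed
  then show ?thesis by blast
qed

end

section \<open>Taylor series of constants\<close>

locale nonarch_differential_field = mixed_char_field v + differential_field D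
  for v :: "'k::field_char_0 \<Rightarrow> real" and D :: "'k \<Rightarrow> 'k" +
  fixes r :: real
  assumes bounded: "bounded_op v D" and r_pos: "0 < r" and r_le: "ereal r \<le> derivation_radius v D"
begin

lemma v_funpow_le:
  assumes "\<And>x. v (L x) \<le> B * v x" "0 \<le> B"
  shows "v ((L ^^ i) x) \<le> B ^ i * v x"
proof (induction i)
  case (Suc i)
  have "v ((L ^^ Suc i) x) \<le> B * v ((L ^^ i) x)" using assms by simp
  also have "\<dots> \<le> B * (B ^ i * v x)" using Suc assms by (intro mult_left_mono)
  finally show ?case by simp
qed simp

text \<open>As \<open>s < r\<close>, some iterate \<open>D ^^ n\<close> has operator norm at most
  \<open>(\<omega> / s) ^ n\<close>. Iterating it, derivatives of order \<open>i\<close> grow like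
  \<open>(\<omega> / s) ^ i\<close>, and dividing by \<open>i!\<close> costs at most
  \<open>\<omega> ^ i\<close>.\<close>

lemma taylor_bound_const:
  assumes s: "0 < s" "s < r"
  shows "\<exists>C. \<forall>a i. v (taylor D a $ i) * s ^ i \<le> C * v a"
proof -
  obtain B0 where B0: "\<And>x. v (D x) \<le> B0 * v x" using bounded by (auto simp: bounded_op_def)
  define B where "B = max 1 B0"
  have B: "1 \<le> B" "v (D x) \<le> B * v x" for x
    using B0[of x] mult_right_mono[of B0 B "v x"] by (auto simp: B_def)
  have DB: "v ((D ^^ i) x) \<le> B ^ i * v x" for i x
    using B by (intro v_funpow_le) auto
  define N where "N i = op_norm v (D ^^ i)" for i
  have bdd: "bdd_above ((\<lambda>x. v ((D ^^ i) x) / v x) ` {x. x \<noteq> 0})" for i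
    using DB[of i] by (intro bdd_aboveI[of _ "B ^ i"]) (auto simp: divide_le_eq v_pos)
  have N: "v ((D ^^ i) x) \<le> N i * v x" for i x
  proof (cases "x = 0")
    case True
    then show ?thesis using DB[of i x] by simp
  next
    case False
    then have "v ((D ^^ i) x) / v x \<le> N i"
      unfolding N_def op_norm_def using bdd by (intro cSUP_upper) auto
    then show ?thesis using False by (simp add: divide_le_eq v_pos)
  qed
  have N0: "0 \<le> N i" for i
    using order_trans[OF v_nonneg N[of i 1]] by simp
  define \<sigma> where "\<sigma> = (INF i\<in>{1..}. root i (N i))"
  have bdd_below: "bdd_below ((\<lambda>i. root i (N i)) ` {1..})"
    using N0 by (intro bdd_belowI[of _ 0]) auto
  have "0 \<le> \<sigma>" unfolding \<sigma>_def using N0 by (intro cINF_greatest) auto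
  \<comment> \<open>If \<open>\<sigma> = 0\<close>, the case of infinite radius, this is positivity
    of the right side.\<close>
  have "\<sigma> < \<omega> / s"
  proof (cases "\<sigma> = 0")
    case False
    then have "r \<le> \<omega> / \<sigma>"
      using r_le \<open>0 \<le> \<sigma>\<close> by (simp add: derivation_radius_def \<sigma>_def N_def)
    then have "\<sigma> * r \<le> \<omega>"
      using False \<open>0 \<le> \<sigma>\<close> by (simp add: pos_le_divide_eq mult.commute)
    moreover have "\<sigma> * s < \<sigma> * r" using False \<open>0 \<le> \<sigma>\<close> s by simp
    ultimately show ?thesis using s by (simp add: pos_less_divide_eq)
  qed (use omega_pos s in simp)
  then obtain n where n: "1 \<le> n" "root n (N n) < \<omega> / s"
    unfolding \<sigma>_def using bdd_below by (subst (asm) cINF_less_iff) auto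
  have Nn: "N n \<le> (\<omega> / s) ^ n"
  proof -
    have "N n = root n (N n) ^ n" using n N0 by simp
    also have "\<dots> \<le> (\<omega> / s) ^ n" using n N0 by (intro power_mono) auto
    finally show ?thesis .
  qed
  \<comment> \<open>Each \<open>i\<close> is split as \<open>t + n * q\<close> with
    \<open>t < n\<close>; the constant absorbs the leftover \<open>t\<close> iterates.\<close>
  define C where "C = (B * max 1 (s / \<omega>)) ^ n"
  have "v (taylor D a $ i) * s ^ i \<le> C * v a" for a i
  proof -
    define q t where "q = i div n" and "t = i mod n"
    have i: "i = t + n * q" by (simp add: q_def t_def)
    have t: "t \<le> n" using n by (simp add: t_def order_less_imp_le)
    have "v ((D ^^ i) a) = v ((D ^^ t) (((D ^^ n) ^^ q) a))"
      by (simp add: i funpow_add funpow_mult mult.commute)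
    also have "\<dots> \<le> B ^ t * v (((D ^^ n) ^^ q) a)" by (rule DB)
    also have "\<dots> \<le> B ^ t * (N n ^ q * v a)"
      using N N0 B by (intro mult_left_mono v_funpow_le) auto
    also have "\<dots> \<le> B ^ t * (((\<omega> / s) ^ n) ^ q * v a)"
      using Nn N0 B by (intro mult_left_mono mult_right_mono power_mono) auto
    also have "((\<omega> / s) ^ n) ^ q = (\<omega> / s) ^ i * (s / \<omega>) ^ t"
      using omega_pos s by (simp add: i power_add power_mult power_divide)
    finally have "v ((D ^^ i) a) \<le> (B * (s / \<omega>)) ^ t * (\<omega> / s) ^ i * v a"
      by (simp only: power_mult_distrib mult_ac)
    also have "\<dots> \<le> C * (\<omega> / s) ^ i * v a"
    proof (intro mult_right_mono)
      have "(B * (s / \<omega>)) ^ t \<le> (B * max 1 (s / \<omega>)) ^ t"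
        using B omega_pos s by (intro power_mono mult_left_mono) auto
      also have "\<dots> \<le> C"
        unfolding C_def using B t mult_mono[of 1 B 1 "max 1 (s / \<omega>)"] by (intro power_increasing) auto
      finally show "(B * (s / \<omega>)) ^ t \<le> C" .
    qed (use omega_pos s in auto)
    finally have "v ((D ^^ i) a) * s ^ i \<le> C * v a * \<omega> ^ i"
      using s by (simp add: power_divide field_simps)
    also have "\<dots> \<le> C * v a * v (fact i)"
      using v_fact_ge[of i] B by (intro mult_left_mono) (auto simp: C_def)
    finally show ?thesis
      using v_pos[of "fact i"] by (simp add: taylor_def v_divide field_simps)
  qed
  then show ?thesis by blast
qed

end

context nonarch_field
begin

text \<open>If \<open>i\<close> is the first index at which \<open>v (F $ i) * s ^ i\<close> is maximal, then \<open>(F $ i)\<^sup>2\<close> dominates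
  the coefficient of \<open>F * F\<close> at \<open>2 i\<close>.\<close>

lemma gauss_bound_square:
  fixes F :: "'k fps"
  assumes s: "0 < s" and lim: "(\<lambda>i. v (F $ i) * s ^ i) \<longlonglongrightarrow> 0"
    and B: "\<And>i. v ((F * F) $ i) * s ^ i \<le> B"
  shows "(v (F $ i) * s ^ i)\<^sup>2 \<le> B"
proof -
  define w where "w i = v (F $ i) * s ^ i" for i
  have w0: "0 \<le> w i" for i using s by (simp add: w_def)
  have "0 \<le> B" using order_trans[OF v_nonneg B[of 0, simplified]] .
  have "(w i)\<^sup>2 \<le> B"
  proof (cases "w i = 0")
    case False
    then have "0 < w i" using w0[of i] by simp
    then have "eventually (\<lambda>j. w j < w i) sequentially"
      using order_tendstoD(2)[OF lim] unfolding w_def by blast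
    then obtain n where n: "\<And>j. j \<ge> n \<Longrightarrow> w j < w i"
      by (auto simp: eventually_sequentially)
    then have "i < n" by (meson less_irrefl not_less)
    \<comment> \<open>All terms from \<open>n\<close> on are below \<open>w i\<close>, so this
      finite maximum is the global one.\<close>
    define M where "M = Max (w ` {..<n})"
    have wM: "w j \<le> M" for j
    proof (cases "j < n")
      case False
      then have "w j < w i" using n by simp
      also have "w i \<le> M" unfolding M_def using \<open>i < n\<close> by (intro Max_ge) auto
      finally show ?thesis by simp
    qed (simp add: M_def)
    have "M \<in> w ` {..<n}" unfolding M_def using \<open>i < n\<close> by (intro Max_in) auto
    then have ex: "\<exists>j. w j = M" by auto
    define k where "k = (LEAST j. w j = M)"
    have k: "w k = M" unfolding k_def using ex by (rule LeastI_ex)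
    have below: "w j < M" if "j < k" for j
      using wM[of j] not_less_Least[of j "\<lambda>j. w j = M"] that unfolding k_def by force
    have M0: "0 < M" using \<open>0 < w i\<close> wM[of i] by simp
    have prod_less: "x * y < M * M" if "0 \<le> x" "x < M" "y \<le> M" for x y
      using mult_left_mono[OF that(3,1)] mult_strict_right_mono[OF that(2) M0] by linarith
    let ?f = "\<lambda>j. F $ j * F $ (2 * k - j)"
    have s2: "s ^ (2 * k) = s ^ k * s ^ k" by (simp add: mult_2 power_add)
    \<comment> \<open>For \<open>j \<noteq> k\<close> one of \<open>j\<close> and
      \<open>2 * k - j\<close> lies below \<open>k\<close>, where \<open>w\<close> is strictly less
      than \<open>M\<close>.\<close>
    have small: "v (?f j) < v (?f k)" if "j \<in> {0..2 * k} - {k}" for j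
    proof -
      have "v (?f j) * s ^ (2 * k) = w j * w (2 * k - j)"
        using that by (simp add: w_def v_mult mult_ac flip: power_add)
      also have "\<dots> < M * M"
      proof (cases "j < k")
        case True
        then show ?thesis using prod_less[of "w j" "w (2 * k - j)"] below wM w0 by simp
      next
        case False
        then have "2 * k - j < k" using that by auto
        then show ?thesis
          using prod_less[of "w (2 * k - j)" "w j"] below wM w0 by (simp add: mult.commute)
      qed
      also have "\<dots> = v (?f k) * s ^ (2 * k)"
        unfolding k[symmetric] w_def s2 v_mult by (simp add: mult_ac)
      finally show ?thesis using s by simp
    qed
    have "0 < v (?f k)"
      using M0 s by (simp add: v_mult zero_less_mult_iff w_def flip: k)
    then have "v (sum ?f ({0..2 * k} - {k})) < v (?f k)"
      using small by (rule v_sum_less)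
    then have "v (?f k + sum ?f ({0..2 * k} - {k})) = v (?f k)"
      by (rule v_add_eq_left)
    moreover have "(F * F) $ (2 * k) = ?f k + sum ?f ({0..2 * k} - {k})"
      unfolding fps_mult_nth by (rule sum.remove) auto
    ultimately have "v ((F * F) $ (2 * k)) * s ^ (2 * k) = M\<^sup>2"
      unfolding k[symmetric] w_def s2 power2_eq_square by (simp add: v_mult mult_ac)
    then have "M\<^sup>2 \<le> B" using B by metis
    moreover have "(w i)\<^sup>2 \<le> M\<^sup>2" using wM w0 by (intro power_mono) auto
    ultimately show ?thesis by simp
  qed (simp add: \<open>0 \<le> B\<close>)
  then show ?thesis by (simp add: w_def)
qed

end

context nonarch_differential_field
begin

text \<open>The bound at an intermediate radius \<open>t\<close> leaves a factor
  \<open>(s / t) ^ i\<close>. The limit lets \<open>gauss_bound_square\<close> be applied to Taylor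
  series.\<close>

lemma taylor_tendsto_0:
  assumes s: "0 < s" "s < r"
  shows "(\<lambda>i. v (taylor D a $ i) * s ^ i) \<longlonglongrightarrow> 0"
proof -
  define t where "t = (s + r) / 2"
  have t: "s < t" "t < r" "0 < t" using s by (auto simp: t_def)
  obtain C where C: "\<And>a i. v (taylor D a $ i) * t ^ i \<le> C * v a"
    using taylor_bound_const[OF t(3,2)] by blast
  have "(\<lambda>i. C * v a * (s / t) ^ i) \<longlonglongrightarrow> C * v a * 0"
    using s t by (intro tendsto_mult tendsto_const LIMSEQ_power_zero) simp
  then have lim: "(\<lambda>i. C * v a * (s / t) ^ i) \<longlonglongrightarrow> 0" by simp
  have "v (taylor D a $ i) * s ^ i \<le> C * v a * (s / t) ^ i" for i
    using mult_right_mono[OF C[of a i], of "(s / t) ^ i"] s t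
    by (simp add: power_divide)
  then show ?thesis
    using s by (intro tendsto_sandwich[OF _ _ tendsto_const lim]) auto
qed

text \<open>The best constant \<open>C\<close> with \<open>v (taylor D a $ i) * s ^ i \<le> C * v a\<close> for all \<open>a\<close> satisfies
  \<open>C\<^sup>2 \<le> C\<close>, since \<open>taylor D\<close> is multiplicative.\<close>

lemma taylor_bound:
  assumes s: "0 < s" "s < r"
  shows "v (taylor D a $ i) * s ^ i \<le> v a"
proof -
  define S where "S = {C. \<forall>a i. v (taylor D a $ i) * s ^ i \<le> C * v a}"
  have "S \<noteq> {}" using taylor_bound_const[OF s] by (auto simp: S_def)
  have S1: "1 \<le> C" if "C \<in> S" for C
  proof -
    from that have "v (taylor D 1 $ 0) * s ^ 0 \<le> C * v 1" unfolding S_def by blast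
    then show ?thesis by (simp add: taylor_1[OF derivation])
  qed
  have bdd: "bdd_below S" using S1 by (rule bdd_belowI)
  define C where "C = Inf S"
  have C: "v (taylor D a $ i) * s ^ i \<le> C * v a" for a i
  proof (cases "a = 0")
    case False
    have "v (taylor D a $ i) * s ^ i / v a \<le> C" unfolding C_def
      using \<open>S \<noteq> {}\<close> False by (intro cInf_greatest) (auto simp: S_def divide_le_eq v_pos)
    then show ?thesis using False by (simp add: divide_le_eq v_pos)
  qed (simp add: taylor_0[OF derivation])
  have "1 \<le> C" unfolding C_def using \<open>S \<noteq> {}\<close> S1 by (intro cInf_greatest)
  have "sqrt C \<in> S"
    unfolding S_def
  proof (intro CollectI allI)
    fix a i
    \<comment> \<open>The square of the series of \<open>a\<close> is the series of
      \<open>a * a\<close>, to which the constant \<open>C\<close> applies.\<close>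
    have "(v (taylor D a $ i) * s ^ i)\<^sup>2 \<le> C * (v a)\<^sup>2"
      using s taylor_tendsto_0[OF s] C[of "a * a"]
      by (intro gauss_bound_square) (auto simp: taylor_mult[OF derivation] v_mult power2_eq_square)
    then have "sqrt ((v (taylor D a $ i) * s ^ i)\<^sup>2) \<le> sqrt (C * (v a)\<^sup>2)"
      by (rule real_sqrt_le_mono)
    then show "v (taylor D a $ i) * s ^ i \<le> sqrt C * v a"
      using s by (simp add: real_sqrt_mult)
  qed
  then have "C \<le> sqrt C" unfolding C_def using bdd by (intro cInf_lower)
  then have "sqrt C * sqrt C \<le> sqrt C * 1" using \<open>1 \<le> C\<close> by simp
  then have "sqrt C \<le> 1" using \<open>1 \<le> C\<close> by (subst (asm) mult_le_cancel_left_pos) auto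
  then have "C \<le> 1" by simp
  then have "C * v a \<le> 1 * v a" by (intro mult_right_mono) auto
  then show ?thesis using C[of a i] by simp
qed

end

section \<open>Gauss norms and operator norms\<close>

context nonarch_field
begin

text \<open>A relation instead of a real-valued Gauss norm, because the supremum over the
  coefficients may be infinite.\<close>

definition gauss_le :: "real \<Rightarrow> 'k fps \<Rightarrow> real \<Rightarrow> bool" where
  "gauss_le s F B \<longleftrightarrow> (\<forall>i. v (F $ i) * s ^ i \<le> B)"

lemma convergent_series_iff: "F \<in> convergent_series v r \<longleftrightarrow> (\<forall>s. 0 < s \<and> s < r \<longrightarrow> (\<exists>B. gauss_le s F B))"
  by (auto simp: convergent_series_def gauss_le_def bdd_above_def)

lemma gauss_le_nonneg: "gauss_le s F B \<Longrightarrow> 0 \<le> B"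
  using order_trans[OF v_nonneg, of "F $ 0" B] by (auto simp: gauss_le_def dest: spec[of _ 0])

lemma gauss_le_mono: "gauss_le s F A \<Longrightarrow> A \<le> B \<Longrightarrow> gauss_le s F B"
  unfolding gauss_le_def by (meson order_trans)

lemma gauss_le_add:
  assumes "0 < s" "gauss_le s F B" "gauss_le s G B"
  shows "gauss_le s (F + G) B"
  unfolding gauss_le_def
proof
  fix i
  have "v ((F + G) $ i) * s ^ i \<le> max (v (F $ i)) (v (G $ i)) * s ^ i"
    using v_add_max assms(1) by (intro mult_right_mono) auto
  also have "\<dots> \<le> B" using assms by (auto simp: gauss_le_def max_def)
  finally show "v ((F + G) $ i) * s ^ i \<le> B" .
qed

lemma gauss_le_uminus: "gauss_le s (- F) B \<longleftrightarrow> gauss_le s F B"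
  by (simp add: gauss_le_def)

lemma gauss_le_diff: "0 < s \<Longrightarrow> gauss_le s F B \<Longrightarrow> gauss_le s G B \<Longrightarrow> gauss_le s (F - G) B"
  using gauss_le_add[of s F B "- G"] by (simp add: gauss_le_uminus)

lemma gauss_le_0: "0 \<le> B \<Longrightarrow> gauss_le s 0 B"
  by (simp add: gauss_le_def)

lemma gauss_le_sum: "0 < s \<Longrightarrow> 0 \<le> B \<Longrightarrow> (\<And>i. i \<in> I \<Longrightarrow> gauss_le s (F i) B) \<Longrightarrow> gauss_le s (sum F I) B"
  by (induction I rule: infinite_finite_induct) (simp_all add: gauss_le_0 gauss_le_add)

lemma gauss_le_mult:
  assumes s: "0 < s" and F: "gauss_le s F A" and G: "gauss_le s G B"
  shows "gauss_le s (F * G) (A * B)"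
  unfolding gauss_le_def
proof
  fix n
  have A: "0 \<le> A" and B: "0 \<le> B" using F G gauss_le_nonneg by auto
  have "v ((F * G) $ n) \<le> A * B / s ^ n"
    unfolding fps_mult_nth
  proof (rule v_sum_le)
    fix i assume "i \<in> {0..n}"
    then have "v (F $ i * G $ (n - i)) * s ^ n = (v (F $ i) * s ^ i) * (v (G $ (n - i)) * s ^ (n - i))"
      by (simp add: v_mult mult_ac flip: power_add)
    also have "\<dots> \<le> A * B"
      using F G A s unfolding gauss_le_def by (intro mult_mono) auto
    finally show "v (F $ i * G $ (n - i)) \<le> A * B / s ^ n"
      using s by (simp add: pos_le_divide_eq)
  qed (use A B s in auto)
  then show "v ((F * G) $ n) * s ^ n \<le> A * B" using s by (simp add: pos_le_divide_eq)
qed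

lemma gauss_le_vanish:
  assumes "0 < s" "\<And>N. gauss_le s F (\<theta> ^ N * B)" "0 \<le> \<theta>" "\<theta> < 1"
  shows "F = 0"
proof (rule fps_ext)
  fix i
  have "(\<lambda>N. \<theta> ^ N * B) \<longlonglongrightarrow> 0 * B"
    using assms by (intro tendsto_mult tendsto_const LIMSEQ_power_zero) auto
  then have "v (F $ i) * s ^ i \<le> 0 * B"
    by (rule LIMSEQ_le_const) (use assms(2) in \<open>auto simp: gauss_le_def\<close>)
  moreover have "0 < s ^ i" using assms(1) by simp
  ultimately have "v (F $ i) \<le> 0" by (simp add: mult_le_0_iff)
  then have "v (F $ i) = 0" using v_nonneg by (rule antisym)
  then show "F $ i = 0 $ i" by simp
qed

lemma higher_deriv_nth:
  "(fps_deriv ^^ i) F $ m = fact (m + i) / fact m * (F $ (m + i) :: 'k)"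
proof (induction i arbitrary: m)
  case (Suc i)
  have "(fps_deriv ^^ Suc i) F $ m = of_nat (m + 1) * (fact (m + 1 + i) / fact (m + 1) * F $ (m + 1 + i))"
    using Suc[of "m + 1"] by simp
  also have "\<dots> = fact (m + Suc i) / fact m * F $ (m + Suc i)"
    by (simp add: field_simps del: of_nat_Suc)
  finally show ?case .
qed simp

text \<open>The factor \<open>(m + i)! / m!\<close> is \<open>i!\<close> times a binomial
  coefficient, and integers have absolute value at most one.\<close>

lemma gauss_le_higher_deriv:
  assumes s: "0 < s" and F: "gauss_le s F B"
  shows "gauss_le s ((fps_deriv ^^ i) F) (v (fact i) / s ^ i * B)"
  unfolding gauss_le_def
proof
  fix m
  have "(fact (m + i) / fact m :: 'k) = fact i * of_nat ((m + i) choose i)"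
    by (simp add: binomial_fact)
  then have "v ((fps_deriv ^^ i) F $ m) = v (fact i) * v (of_nat ((m + i) choose i)) * v (F $ (m + i))"
    by (simp add: higher_deriv_nth v_mult)
  also have "\<dots> \<le> v (fact i) * 1 * v (F $ (m + i))"
    by (intro mult_mono v_of_nat_le_1) auto
  finally have "v ((fps_deriv ^^ i) F $ m) * s ^ m \<le> v (fact i) * v (F $ (m + i)) * s ^ m"
    using s by (intro mult_right_mono) auto
  also have "\<dots> = v (fact i) / s ^ i * (v (F $ (m + i)) * s ^ (m + i))"
    using s by (simp add: power_add)
  also have "\<dots> \<le> v (fact i) / s ^ i * B"
    using F s by (intro mult_left_mono) (auto simp: gauss_le_def)
  finally show "v ((fps_deriv ^^ i) F $ m) * s ^ m \<le> v (fact i) / s ^ i * B" .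
qed

lemma v_limit_bound:
  assumes lim: "(\<lambda>m. v (l - x m)) \<longlonglongrightarrow> 0" and B: "\<And>m. m \<ge> n \<Longrightarrow> v (x m - x n) \<le> B"
  shows "v (l - x n) \<le> B"
proof -
  have "v (l - x n) \<le> v (l - x m) + B" if "m \<ge> n" for m
    using v_triangle[of "l - x m" "x m - x n"] B[OF that] by simp
  then have "eventually (\<lambda>m. v (l - x n) \<le> v (l - x m) + B) sequentially"
    unfolding eventually_sequentially by blast
  moreover have "(\<lambda>m. v (l - x m) + B) \<longlonglongrightarrow> 0 + B"
    by (intro tendsto_add lim tendsto_const)
  ultimately have "v (l - x n) \<le> 0 + B"
    by (intro tendsto_le[OF sequentially_bot _ tendsto_const])
  then show ?thesis by simp
qed

lemma v_telescope_bound: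
  assumes "\<And>n. v (x (Suc n) - x n) \<le> C * \<theta> ^ n" "0 \<le> \<theta>" "\<theta> \<le> 1" "0 \<le> C" "n \<le> m"
  shows "v (x m - x n) \<le> C * \<theta> ^ n"
  using \<open>n \<le> m\<close>
proof (induction m rule: dec_induct)
  case base
  then show ?case using assms by simp
next
  case (step m)
  have "C * \<theta> ^ m \<le> C * \<theta> ^ n" using step assms by (intro mult_left_mono power_decreasing) auto
  then show ?case
    using v_add_max[of "x (Suc m) - x m" "x m - x n"] step.IH assms(1)[of m] by simp
qed

text \<open>In the ultrametric setting a bound on consecutive differences bounds all later
  differences, so the sequence is Cauchy. It is used for coefficients of series and for coordinates
  modulo closed subspaces.\<close>

lemma complete_geometric:
  assumes complete: "complete_abs v"
    and x: "\<And>n. v (x (Suc n) - x n) \<le> C * \<theta> ^ n" and \<theta>: "0 \<le> \<theta>" "\<theta> < 1" and C: "0 \<le> C"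
  shows "\<exists>l. (\<lambda>n. v (l - x n)) \<longlonglongrightarrow> 0"
proof -
  interpret M: Metric_space UNIV "\<lambda>x y. v (x - y)"
  proof
    show "v (x - y) = v (y - x)" for x y using v_minus[of "x - y"] by simp
    show "v (x - z) \<le> v (x - y) + v (y - z)" for x y z
      using v_triangle[of "x - y" "y - z"] by simp
  qed auto
  have lim0: "(\<lambda>n. C * \<theta> ^ n) \<longlonglongrightarrow> 0"
    using tendsto_mult[OF tendsto_const LIMSEQ_power_zero, of \<theta> C] \<theta> by simp
  have "M.MCauchy x"
    unfolding M.MCauchy_def
  proof (intro conjI allI impI)
    fix \<epsilon> :: real assume "\<epsilon> > 0"
    then obtain N where N: "C * \<theta> ^ N < \<epsilon>"
      using order_tendstoD(2)[OF lim0] by (auto simp: eventually_sequentially)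
    have "v (x n - x n') < \<epsilon>" if "N \<le> n" "N \<le> n'" for n n'
      using v_diff_max[of "x n - x N" "x n' - x N"] N
        v_telescope_bound[OF x \<theta>(1) less_imp_le[OF \<theta>(2)] C that(1)]
        v_telescope_bound[OF x \<theta>(1) less_imp_le[OF \<theta>(2)] C that(2)] by simp
    then show "\<exists>N. \<forall>n n'. N \<le> n \<longrightarrow> N \<le> n' \<longrightarrow> v (x n - x n') < \<epsilon>" by blast
  qed simp
  then obtain l where "limitin M.mtopology x l sequentially"
    using complete unfolding complete_abs_def M.mcomplete_def by blast
  then have "(\<lambda>n. v (x n - l)) \<longlonglongrightarrow> 0"
    by (simp add: M.limitin_metric_dist_null)
  moreover have "v (x n - l) = v (l - x n)" for n using v_minus[of "x n - l"] by simp
  ultimately show ?thesis by (intro exI[of _ l]) (simp only:)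
qed

end

section \<open>The operator norm on twisted polynomials\<close>

context nonarch_differential_field
begin

definition twisted_norm :: "real \<Rightarrow> 'k poly \<Rightarrow> real" where
  "twisted_norm s P = Max ((\<lambda>i. v (coeff P i) * v (fact i) / s ^ i) ` {..degree P})"

lemma twisted_norm_ge:
  assumes "0 < s"
  shows "v (coeff P i) * v (fact i) / s ^ i \<le> twisted_norm s P"
proof -
  have ge: "v (coeff P i) * v (fact i) / s ^ i \<le> twisted_norm s P" if "i \<le> degree P" for i
    unfolding twisted_norm_def using that by (intro Max_ge) auto
  have "0 \<le> twisted_norm s P" by (rule order_trans[OF _ ge[of 0]]) simp_all
  then show ?thesis using ge[of i] by (cases "i \<le> degree P") (simp_all add: coeff_eq_0)
qed

lemma twisted_norm_leI: "(\<And>i. v (coeff P i) * v (fact i) / s ^ i \<le> B) \<Longrightarrow> twisted_norm s P \<le> B"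
  unfolding twisted_norm_def by (intro Max.boundedI) auto

lemma twisted_norm_nonneg: "0 < s \<Longrightarrow> 0 \<le> twisted_norm s P"
  by (rule order_trans[OF _ twisted_norm_ge[of s P 0]]) simp_all

text \<open>Smallness of \<open>1 - L \<star> Q\<close> at one radius thereby passes to larger
  radii.\<close>

lemma twisted_norm_antimono:
  assumes "0 < s" "s \<le> t"
  shows "twisted_norm t P \<le> twisted_norm s P"
proof (rule twisted_norm_leI)
  fix i
  have "v (coeff P i) * v (fact i) / t ^ i \<le> v (coeff P i) * v (fact i) / s ^ i"
    using assms by (intro divide_left_mono power_mono mult_pos_pos zero_less_power) auto
  then show "v (coeff P i) * v (fact i) / t ^ i \<le> twisted_norm s P"
    using twisted_norm_ge[OF assms(1), of P i] by simp
qed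

lemma twisted_norm_add:
  assumes "0 < s"
  shows "twisted_norm s (P + Q) \<le> max (twisted_norm s P) (twisted_norm s Q)"
proof (rule twisted_norm_leI)
  fix i
  have "v (coeff (P + Q) i) \<le> v (coeff P i) \<or> v (coeff (P + Q) i) \<le> v (coeff Q i)"
    using v_add_max[of "coeff P i" "coeff Q i"] by (simp add: le_max_iff_disj)
  then show "v (coeff (P + Q) i) * v (fact i) / s ^ i \<le> max (twisted_norm s P) (twisted_norm s Q)"
  proof
    assume "v (coeff (P + Q) i) \<le> v (coeff P i)"
    then have "v (coeff (P + Q) i) * v (fact i) / s ^ i \<le> v (coeff P i) * v (fact i) / s ^ i"
      using assms by (intro divide_right_mono mult_right_mono) simp_all
    then show ?thesis using twisted_norm_ge[OF assms, of P i] by linarith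
  next
    assume "v (coeff (P + Q) i) \<le> v (coeff Q i)"
    then have "v (coeff (P + Q) i) * v (fact i) / s ^ i \<le> v (coeff Q i) * v (fact i) / s ^ i"
      using assms by (intro divide_right_mono mult_right_mono) simp_all
    then show ?thesis using twisted_norm_ge[OF assms, of Q i] by linarith
  qed
qed

lemma twisted_norm_uminus: "twisted_norm s (- P) = twisted_norm s P"
  by (simp add: twisted_norm_def)

lemma twisted_norm_diff: "0 < s \<Longrightarrow> twisted_norm s (P - Q) \<le> max (twisted_norm s P) (twisted_norm s Q)"
  using twisted_norm_add[of s P "- Q"] by (simp add: twisted_norm_uminus)

lemma twisted_norm_const: "twisted_norm s [:c:] = v c"
  by (simp add: twisted_norm_def)

lemma twisted_norm_monom: "0 < s \<Longrightarrow> twisted_norm s (monom 1 k) \<le> v (fact k) / s ^ k"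
  by (rule twisted_norm_leI) simp

lemma gauss_le_taylor: "0 < s \<Longrightarrow> s < r \<Longrightarrow> gauss_le s (taylor D a) (v a)"
  by (simp add: gauss_le_def taylor_bound)

text \<open>Multiplication by the Taylor series of \<open>a\<close> has norm at most
  \<open>v a\<close>, the \<open>i\<close>-th derivative has norm at most
  \<open>v (fact i) / s ^ i\<close>, and a sum is bounded by its largest term.\<close>

lemma gauss_le_act:
  assumes s: "0 < s" "s < r" and F: "gauss_le s F B"
  shows "gauss_le s (P \<triangleright> F) (twisted_norm s P * B)"
  unfolding twisted_act_def
proof (rule gauss_le_sum)
  fix i
  have "gauss_le s (taylor D (coeff P i) * (fps_deriv ^^ i) F) (v (coeff P i) * (v (fact i) / s ^ i * B))"
    using s F by (intro gauss_le_mult gauss_le_taylor gauss_le_higher_deriv)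
  moreover have "v (coeff P i) * v (fact i) / s ^ i * B \<le> twisted_norm s P * B"
    using s gauss_le_nonneg[OF F] by (intro mult_right_mono twisted_norm_ge)
  then have "v (coeff P i) * (v (fact i) / s ^ i * B) \<le> twisted_norm s P * B"
    by simp
  ultimately show "gauss_le s (taylor D (coeff P i) * (fps_deriv ^^ i) F) (twisted_norm s P * B)"
    by (rule gauss_le_mono)
next
  show "0 \<le> twisted_norm s P * B"
    using twisted_norm_nonneg[OF s(1)] gauss_le_nonneg[OF F] by (rule mult_nonneg_nonneg)
qed (rule s)

lemma act_nth_0: "(P \<triangleright> F) $ 0 = (\<Sum>i\<le>degree P. coeff P i * (fact i * F $ i))"
  by (simp add: twisted_act_def fps_sum_nth taylor_def higher_deriv_nth)

text \<open>\<^const>\<open>twisted_norm\<close> is the operator norm on the series that are bounded for the radius \<open>s\<close>,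
  as seen by evaluating at powers of the variable.  Hence it is submultiplicative.\<close>

lemma twisted_norm_le_if_act:
  assumes s: "0 < s" and B: "\<And>F A. gauss_le s F A \<Longrightarrow> gauss_le s (P \<triangleright> F) (B * A)"
  shows "twisted_norm s P \<le> B"
proof (rule twisted_norm_leI)
  fix m
  have "gauss_le s (fps_X ^ m) (s ^ m)"
    using s by (simp add: gauss_le_def fps_X_power_nth)
  then have "v ((P \<triangleright> fps_X ^ m) $ 0) * s ^ 0 \<le> B * s ^ m"
    using B unfolding gauss_le_def by blast
  moreover have "(P \<triangleright> fps_X ^ m) $ 0 = coeff P m * fact m"
  proof -
    have "(P \<triangleright> fps_X ^ m) $ 0 = (\<Sum>i\<le>degree P. if i = m then coeff P m * fact m else 0)"
      unfolding act_nth_0 by (intro sum.cong) (auto simp: fps_X_power_nth)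
    also have "\<dots> = coeff P m * fact m" by (auto simp: coeff_eq_0)
    finally show ?thesis .
  qed
  ultimately show "v (coeff P m) * v (fact m) / s ^ m \<le> B"
    using s by (simp add: v_mult pos_divide_le_eq)
qed

lemma twisted_norm_mult:
  assumes s: "0 < s" "s < r"
  shows "twisted_norm s (P \<star> Q) \<le> twisted_norm s P * twisted_norm s Q"
proof (rule twisted_norm_le_if_act[OF s(1)])
  fix F A assume "gauss_le s F A"
  then have "gauss_le s (P \<triangleright> Q \<triangleright> F) (twisted_norm s P * (twisted_norm s Q * A))"
    using s by (intro gauss_le_act)
  then show "gauss_le s ((P \<star> Q) \<triangleright> F) (twisted_norm s P * twisted_norm s Q * A)"
    by (simp add: twisted_act_twisted_mult[OF derivation] mult.assoc)
qed

lemma act_1: "1 \<triangleright> F = F"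
  using twisted_act_const[OF derivation, of 1 F] by (simp add: taylor_1[OF derivation] one_pCons)

lemma act_0_right: "P \<triangleright> 0 = 0"
  using twisted_act_add_right[OF derivation, of P 0 0] by simp

lemma act_diff_right: "P \<triangleright> (F - G) = P \<triangleright> F - P \<triangleright> G"
  using twisted_act_add_right[OF derivation, of P "F - G" G] by (simp add: algebra_simps)

lemma act_diff_left: "(P - Q) \<triangleright> F = P \<triangleright> F - Q \<triangleright> F"
  using twisted_act_add_left[OF derivation, of "P - Q" Q F] by (simp add: algebra_simps)

lemma act_sum_left: "(\<Sum>i\<in>I. P i) \<triangleright> F = (\<Sum>i\<in>I. P i \<triangleright> F)"
  by (induction I rule: infinite_finite_induct)
    (simp_all add: twisted_act_0[OF derivation] twisted_act_add_left[OF derivation])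

lemma gauss_le_radius_mono:
  assumes "0 < s" "s \<le> t" "gauss_le t F B"
  shows "gauss_le s F B"
  unfolding gauss_le_def
proof
  fix i
  have "v (F $ i) * s ^ i \<le> v (F $ i) * t ^ i"
    using assms by (intro mult_left_mono power_mono) simp_all
  also have "\<dots> \<le> B" using assms by (simp add: gauss_le_def)
  finally show "v (F $ i) * s ^ i \<le> B" .
qed

lemma act_convergent:
  assumes "F \<in> convergent_series v r"
  shows "P \<triangleright> F \<in> convergent_series v r"
  using assms gauss_le_act unfolding convergent_series_iff by blast

lemma left_module_convergent_series: "left_module (twisted_poly_ring D) (convergent_series_module v D r)"
proof -
  interpret P: left_module "twisted_poly_ring D" "power_series_module D"
    by (rule left_module_power_series[OF derivation])
  have add: "F + G \<in> convergent_series v r"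
    if FG: "F \<in> convergent_series v r" "G \<in> convergent_series v r" for F G
    unfolding convergent_series_iff
  proof (intro allI impI, elim conjE)
    fix s assume s: "0 < s" "s < r"
    obtain A B where A: "gauss_le s F A" and B: "gauss_le s G B"
      using FG s unfolding convergent_series_iff by blast
    have "gauss_le s (F + G) (max A B)"
      using gauss_le_mono[OF A, of "max A B"] gauss_le_mono[OF B, of "max A B"] s
      by (intro gauss_le_add) simp_all
    then show "\<exists>B. gauss_le s (F + G) B" ..
  qed
  have uminus: "- F \<in> convergent_series v r" if "F \<in> convergent_series v r" for F
    using that by (simp add: convergent_series_iff gauss_le_uminus)
  have zero: "0 \<in> convergent_series v r"
    using gauss_le_0[of 0] by (auto simp: convergent_series_iff)
  show ?thesis
  proof (intro left_module.intro left_module_axioms.intro ring_twisted_poly_ring derivation)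
    show "abelian_group (convergent_series_module v D r)"
    proof (rule abelian_groupI)
      fix x assume "x \<in> carrier (convergent_series_module v D r)"
      then show "\<exists>y\<in>carrier (convergent_series_module v D r).
          y \<oplus>\<^bsub>convergent_series_module v D r\<^esub> x = \<zero>\<^bsub>convergent_series_module v D r\<^esub>"
        using uminus by (intro bexI[of _ "- x"])
          (simp_all add: convergent_series_module_def power_series_module_def)
    qed (use zero add in \<open>simp_all add: convergent_series_module_def power_series_module_def algebra_simps\<close>)
  qed (use P.smult_one P.smult_assoc P.smult_l_distr P.smult_r_distr act_convergent in
      \<open>simp_all add: convergent_series_module_def power_series_module_def\<close>)
qed

end

section \<open>Right invertible operators\<close>

locale complete_differential_field = nonarch_differential_field v D r
  for v :: "'k::field_char_0 \<Rightarrow> real" and D :: "'k \<Rightarrow> 'k" and r :: real +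
  assumes complete: "complete_abs v"
begin

lemma solvable_if_right_invertible:
  assumes s: "0 < s" "s < r" and small: "twisted_norm s (1 - L \<star> Q) < 1"
    and g: "g \<in> convergent_series v r"
  shows "\<exists>f\<in>convergent_series v r. L \<triangleright> f = g"
proof -
  define U where "U = 1 - L \<star> Q"
  define \<theta> where "\<theta> = twisted_norm s U"
  have \<theta>: "0 \<le> \<theta>" "\<theta> < 1" using small twisted_norm_nonneg[OF s(1)] by (simp_all add: \<theta>_def U_def)
  define h where "h k = ((\<lambda>F. U \<triangleright> F) ^^ k) g" for k
  define S where "S N = (\<Sum>k<N. h k)" for N
  \<comment> \<open>For \<open>t \<ge> s\<close> the norm of \<open>U\<close> at \<open>t\<close> is
    at most \<open>\<theta>\<close>, so a single factor serves all radii from \<open>s\<close> up to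
    \<open>r\<close>.\<close>
  have h_le: "gauss_le t (h k) (\<theta> ^ k * B)" if t: "s \<le> t" "t < r" "gauss_le t g B" for t k B
  proof (induction k)
    case 0
    then show ?case using t by (simp add: h_def)
  next
    case (Suc k)
    have "0 < t" using s t by simp
    then have "gauss_le t (U \<triangleright> h k) (twisted_norm t U * (\<theta> ^ k * B))"
      using gauss_le_act[OF _ t(2) Suc] by blast
    moreover have "twisted_norm t U * (\<theta> ^ k * B) \<le> \<theta> * (\<theta> ^ k * B)"
      using twisted_norm_antimono[OF s(1) t(1), of U] \<theta> gauss_le_nonneg[OF t(3)]
      by (intro mult_right_mono) (simp_all add: \<theta>_def)
    ultimately have "gauss_le t (U \<triangleright> h k) (\<theta> * (\<theta> ^ k * B))" by (rule gauss_le_mono)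
    then show ?case by (simp add: h_def mult.assoc)
  qed
  have S_le: "gauss_le t (S m - S n) (\<theta> ^ n * B)" if t: "s \<le> t" "t < r" "gauss_le t g B" and "n \<le> m" for t B m n
  proof -
    have B0: "0 \<le> B" using gauss_le_nonneg t by blast
    have "S m - S n = (\<Sum>k\<in>{n..<m}. h k)"
      using \<open>n \<le> m\<close> unfolding S_def by (simp add: lessThan_atLeast0 sum_diff_nat_ivl)
    moreover have "gauss_le t (h k) (\<theta> ^ n * B)" if "k \<in> {n..<m}" for k
      using that \<theta> B0 by (intro gauss_le_mono[OF h_le[OF t]] mult_right_mono power_decreasing) simp_all
    moreover have "0 < t" "0 \<le> \<theta> ^ n * B" using \<theta> B0 s t by simp_all
    ultimately show ?thesis by (simp only: gauss_le_sum)
  qed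
  obtain B0 where B0: "gauss_le s g B0" using g s by (auto simp: convergent_series_iff)
  have B0': "0 \<le> B0" using gauss_le_nonneg B0 by blast
  have "\<exists>l. (\<lambda>n. v (l - S n $ i)) \<longlonglongrightarrow> 0" for i
  proof (rule complete_geometric[OF complete _ \<theta>])
    fix n
    have "v (h n $ i) * s ^ i \<le> \<theta> ^ n * B0"
      using h_le[OF order_refl s(2) B0] by (simp add: gauss_le_def)
    then show "v (S (Suc n) $ i - S n $ i) \<le> B0 / s ^ i * \<theta> ^ n"
      using s by (simp add: S_def field_simps)
  qed (use B0' s in simp)
  then obtain l where l: "\<And>i. (\<lambda>n. v (l i - S n $ i)) \<longlonglongrightarrow> 0" by metis
  define H where "H = Abs_fps l"
  have H_le: "gauss_le t (H - S n) (\<theta> ^ n * B)" if t: "s \<le> t" "t < r" "gauss_le t g B" for t B n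
    unfolding gauss_le_def
  proof
    fix i
    have "0 < t" using s t by simp
    have "v (l i - S n $ i) \<le> \<theta> ^ n * B / t ^ i"
    proof (rule v_limit_bound[OF l])
      fix m assume "n \<le> m"
      then show "v (S m $ i - S n $ i) \<le> \<theta> ^ n * B / t ^ i"
        using S_le[OF t, of n m] \<open>0 < t\<close> by (simp add: gauss_le_def pos_le_divide_eq)
    qed
    then show "v ((H - S n) $ i) * t ^ i \<le> \<theta> ^ n * B"
      using \<open>0 < t\<close> by (simp add: H_def pos_le_divide_eq)
  qed
  have H: "H \<in> convergent_series v r"
    unfolding convergent_series_iff
  proof (intro allI impI, elim conjE)
    fix t assume t: "0 < t" "t < r"
    \<comment> \<open>The estimates hold from radius \<open>s\<close> on, so a smaller radius
      \<open>t\<close> is reached from \<open>max s t\<close>.\<close>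
    have t': "0 < max s t" "s \<le> max s t" "max s t < r" using s t by simp_all
    then obtain B where "gauss_le (max s t) g B" using g unfolding convergent_series_iff by blast
    then have "gauss_le (max s t) H B" using H_le[OF t'(2,3), of B 0] by (simp add: S_def)
    then show "\<exists>B. gauss_le t H B" using gauss_le_radius_mono[of t "max s t"] t by auto
  qed
  have S_eq: "S N + h N = g + U \<triangleright> S N" for N
  proof (induction N)
    case 0
    then show ?case by (simp add: S_def h_def act_0_right)
  next
    case (Suc N)
    have "U \<triangleright> S (Suc N) = U \<triangleright> S N + h (Suc N)"
      by (simp add: S_def h_def twisted_act_add_right[OF derivation])
    then show ?case using Suc by (simp add: S_def)
  qed
  \<comment> \<open>By \<open>S_eq\<close> the partial sum \<open>S N\<close> solves the equation up
    to \<open>h N\<close>, so the defect of \<open>H\<close> is bounded by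
    \<open>\<theta> ^ N * B0\<close> for every \<open>N\<close>.\<close>
  have "H - U \<triangleright> H - g = 0"
  proof (rule gauss_le_vanish[OF s(1) _ \<theta>])
    fix N
    have bound: "gauss_le s (H - S N) (\<theta> ^ N * B0)" using H_le[OF order_refl s(2) B0] .
    have "gauss_le s (U \<triangleright> (H - S N)) (\<theta> * (\<theta> ^ N * B0))"
      using gauss_le_act[OF s bound] by (simp add: \<theta>_def)
    moreover have "\<theta> * (\<theta> ^ N * B0) \<le> \<theta> ^ N * B0"
      using \<theta> B0' by (intro mult_left_le_one_le) simp_all
    ultimately have "gauss_le s (U \<triangleright> (H - S N)) (\<theta> ^ N * B0)" by (rule gauss_le_mono)
    then have "gauss_le s ((H - S N) - U \<triangleright> (H - S N) - h N) (\<theta> ^ N * B0)"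
      by (rule gauss_le_diff[OF s(1) gauss_le_diff[OF s(1) bound] h_le[OF order_refl s(2) B0]])
    moreover have "(H - S N) - U \<triangleright> (H - S N) - h N = H - U \<triangleright> H - g"
      using S_eq[of N] by (simp add: act_diff_right algebra_simps)
    ultimately show "gauss_le s (H - U \<triangleright> H - g) (\<theta> ^ N * B0)" by simp
  qed
  moreover have "L \<triangleright> Q \<triangleright> H = (1 - U) \<triangleright> H"
    by (simp add: U_def twisted_act_twisted_mult[OF derivation])
  ultimately have "L \<triangleright> Q \<triangleright> H = g"
    by (simp add: act_diff_left act_1)
  then show ?thesis using act_convergent[OF H] by blast
qed

end

section \<open>Closed right ideals\<close>

context complete_differential_field
begin

definition norm_closed :: "real \<Rightarrow> 'k poly set \<Rightarrow> bool" where
  "norm_closed s W \<longleftrightarrow> (\<forall>x. (\<forall>\<epsilon>>0. \<exists>w\<in>W. twisted_norm s (x - w) < \<epsilon>) \<longrightarrow> x \<in> W)"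

text \<open>Scalars act from the right, so that right ideals are subspaces and those generated by a
  nonzero \<open>L\<close> have finite codimension.\<close>

definition right_subspace :: "'k poly set \<Rightarrow> bool" where
  "right_subspace W \<longleftrightarrow> 0 \<in> W \<and> (\<forall>x\<in>W. \<forall>y\<in>W. x + y \<in> W) \<and> (\<forall>x\<in>W. \<forall>a. x \<star> [:a:] \<in> W)"

lemma const_times_const: "[:a:] \<star> [:b:] = [:a * b:]"
  by (simp add: twisted_mult_def)

lemma times_const_assoc: "P \<star> [:a:] \<star> [:b:] = P \<star> [:a * b:]"
  by (simp add: times_assoc const_times_const)

lemma times_const_add: "P \<star> [:a + b:] = P \<star> [:a:] + P \<star> [:b:]"
  by (simp flip: twisted_mult_add_right[OF derivation])

lemma times_const_one: "P \<star> [:1:] = P"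
  by (simp add: twisted_simps flip: one_pCons)

lemma times_const_minus: "P \<star> [:- a:] = - (P \<star> [:a:])"
  using times_const_add[of P a "- a"] by (simp add: times_0_right eq_neg_iff_add_eq_0 add.commute)

lemma right_subspace_uminus: "right_subspace W \<Longrightarrow> x \<in> W \<Longrightarrow> - x \<in> W"
  using times_const_minus[of x 1] unfolding right_subspace_def by (metis times_const_one)

lemma twisted_norm_times_const:
  assumes "0 < s" "s < r"
  shows "twisted_norm s (P \<star> [:a:]) \<le> twisted_norm s P * v a"
  using twisted_norm_mult[OF assms, of P "[:a:]"] by (simp add: twisted_norm_const)

text \<open>Closedness gives a positive distance \<open>\<epsilon>\<close> from \<open>b\<close> to
  \<open>W\<close>. Right multiplication by \<open>[:1 / a:]\<close> turns
  \<open>w + b \<star> [:a:]\<close> into \<open>b\<close> minus an element of \<open>W\<close>, so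
  \<open>C = 1 / \<epsilon>\<close> works.\<close>

lemma closed_subspace_coordinate_bound:
  assumes s: "0 < s" "s < r" and W: "right_subspace W" "norm_closed s W" and b: "b \<notin> W"
  shows "\<exists>C>0. \<forall>w\<in>W. \<forall>a. v a \<le> C * twisted_norm s (w + b \<star> [:a:])"
proof -
  obtain \<epsilon> where \<epsilon>: "\<epsilon> > 0" "\<And>w. w \<in> W \<Longrightarrow> \<epsilon> \<le> twisted_norm s (b - w)"
    using W(2) b unfolding norm_closed_def by (meson not_less)
  have "v a \<le> 1 / \<epsilon> * twisted_norm s (w + b \<star> [:a:])" if w: "w \<in> W" for w a
  proof (cases "a = 0")
    case True
    then show ?thesis using \<epsilon> twisted_norm_nonneg[OF s(1)] by simp
  next
    case False
    let ?w = "- (w \<star> [:1 / a:])"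
    have "?w \<in> W" using W(1) w right_subspace_uminus unfolding right_subspace_def by blast
    then have "\<epsilon> \<le> twisted_norm s (b - ?w)" by (rule \<epsilon>)
    also have "b - ?w = (w + b \<star> [:a:]) \<star> [:1 / a:]"
      using False by (simp add: twisted_simps times_const_assoc times_const_one)
    also have "twisted_norm s \<dots> \<le> twisted_norm s (w + b \<star> [:a:]) * v (1 / a)"
      by (rule twisted_norm_times_const[OF s])
    finally show ?thesis using \<epsilon>(1) v_pos[OF False] by (simp add: v_divide field_simps)
  qed
  then show ?thesis using \<epsilon>(1) by (intro exI[of _ "1 / \<epsilon>"]) simp
qed

text \<open>The coordinate bound makes the \<open>b\<close>-coordinates of approximations to
  \<open>x\<close> a Cauchy sequence. With its limit \<open>l\<close>, the element
  \<open>x - b \<star> [:l:]\<close> is approximated by \<open>W\<close> and hence lies in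
  it.\<close>

lemma closed_subspace_extend:
  assumes s: "0 < s" "s < r" and W: "right_subspace W" "norm_closed s W" and b: "b \<notin> W"
  shows "norm_closed s {w + b \<star> [:a:] |w a. w \<in> W}"
  unfolding norm_closed_def
proof (intro allI impI)
  let ?W = "{w + b \<star> [:a:] |w a. w \<in> W}"
  obtain C where C: "C > 0" "\<And>w a. w \<in> W \<Longrightarrow> v a \<le> C * twisted_norm s (w + b \<star> [:a:])"
    using closed_subspace_coordinate_bound[OF assms] by blast
  fix x assume x: "\<forall>\<epsilon>>0. \<exists>w\<in>?W. twisted_norm s (x - w) < \<epsilon>"
  have "\<exists>w a. w \<in> W \<and> twisted_norm s (x - (w + b \<star> [:a:])) < (1 / 2) ^ n" for n
    using x[rule_format, of "(1 / 2) ^ n"] by auto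
  then obtain w a where w: "\<And>n. w n \<in> W"
    and wa: "\<And>n. twisted_norm s (x - (w n + b \<star> [:a n:])) < (1 / 2) ^ n" by metis
  have "v (a (Suc n) - a n) \<le> C * (1 / 2) ^ n" for n
  proof -
    have "w (Suc n) - w n \<in> W"
      using W(1) w right_subspace_uminus[OF W(1) w] unfolding right_subspace_def
      by (metis add_uminus_conv_diff)
    then have "v (a (Suc n) - a n) \<le> C * twisted_norm s (w (Suc n) - w n + b \<star> [:a (Suc n) - a n:])"
      by (rule C)
    also have "w (Suc n) - w n + b \<star> [:a (Suc n) - a n:]
        = (x - (w n + b \<star> [:a n:])) - (x - (w (Suc n) + b \<star> [:a (Suc n):]))"
      using times_const_add[of b "a (Suc n) - a n" "a n"] by (simp add: algebra_simps)
    also have "twisted_norm s \<dots> \<le> (1 / 2) ^ n"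
    proof -
      have "(1 / 2 :: real) ^ Suc n \<le> (1 / 2) ^ n" by simp
      then show ?thesis
        using twisted_norm_diff[OF s(1), of "x - (w n + b \<star> [:a n:])" "x - (w (Suc n) + b \<star> [:a (Suc n):])"]
          wa[of n] wa[of "Suc n"] by linarith
    qed
    finally show ?thesis using C(1) by simp
  qed
  then obtain l where l: "(\<lambda>n. v (l - a n)) \<longlonglongrightarrow> 0"
    using complete_geometric[OF complete, of a C "1 / 2"] C(1) by auto
  have "x - b \<star> [:l:] \<in> W"
  proof (rule W(2)[unfolded norm_closed_def, rule_format])
    fix \<epsilon> :: real assume "\<epsilon> > 0"
    define N where "N = twisted_norm s b + 1"
    have "N > 0" using twisted_norm_nonneg[OF s(1), of b] by (simp add: N_def)
    have "(\<lambda>n. (1 / 2 :: real) ^ n) \<longlonglongrightarrow> 0" by (intro LIMSEQ_power_zero) simp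
    then have "eventually (\<lambda>n. (1 / 2) ^ n < \<epsilon>) sequentially" using \<open>\<epsilon> > 0\<close> by (rule order_tendstoD)
    moreover have "eventually (\<lambda>n. v (l - a n) < \<epsilon> / N) sequentially"
      using \<open>\<epsilon> > 0\<close> \<open>N > 0\<close> by (intro order_tendstoD(2)[OF l] divide_pos_pos)
    ultimately have "eventually (\<lambda>n. (1 / 2) ^ n < \<epsilon> \<and> v (l - a n) < \<epsilon> / N) sequentially"
      by (rule eventually_conj)
    then obtain n where n: "(1 / 2) ^ n < \<epsilon>" "v (l - a n) < \<epsilon> / N"
      by (auto simp: eventually_sequentially)
    have eq: "x - b \<star> [:l:] - w n = (x - (w n + b \<star> [:a n:])) - b \<star> [:l - a n:]"
      using times_const_add[of b "l - a n" "a n"] by (simp add: algebra_simps)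
    have "twisted_norm s (b \<star> [:l - a n:]) < \<epsilon>"
    proof -
      have "twisted_norm s (b \<star> [:l - a n:]) \<le> twisted_norm s b * v (l - a n)"
        by (rule twisted_norm_times_const[OF s])
      also have "\<dots> \<le> N * v (l - a n)" by (intro mult_right_mono) (simp_all add: N_def)
      also have "\<dots> < \<epsilon>" using n(2) \<open>N > 0\<close> by (simp add: field_simps)
      finally show ?thesis .
    qed
    then have "twisted_norm s (x - b \<star> [:l:] - w n) < \<epsilon>"
      unfolding eq using twisted_norm_diff[OF s(1), of "x - (w n + b \<star> [:a n:])" "b \<star> [:l - a n:]"] wa[of n] n(1)
      by linarith
    then show "\<exists>w\<in>W. twisted_norm s (x - b \<star> [:l:] - w) < \<epsilon>" using w by blast
  qed
  then have "(x - b \<star> [:l:]) + b \<star> [:l:] \<in> ?W" by blast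
  then show "x \<in> ?W" by simp
qed

end

section \<open>Twisted polynomials with coefficients on the right\<close>

context differential_field
begin

text \<open>Right coefficients are coordinates for the right action of \<open>K\<close>, the one
  that respects right ideals.\<close>

definition right_poly :: "nat \<Rightarrow> (nat \<Rightarrow> 'k) \<Rightarrow> 'k poly" where
  "right_poly n c = (\<Sum>i<n. monom 1 i \<star> [:c i:])"

lemma monom_times: "monom 1 i \<star> Q = (T_mult D ^^ i) Q"
proof -
  have "monom 1 i \<star> Q = (\<Sum>j\<le>i. if j = i then (T_mult D ^^ i) Q else 0)"
    unfolding twisted_mult_def degree_monom_eq[OF one_neq_zero] by (intro sum.cong) auto
  then show ?thesis by simp
qed

lemma monom_times_monom: "monom 1 i \<star> monom 1 j = monom 1 (i + j)"
  unfolding monom_times by (induction i) (simp_all add: T_mult_monom[OF derivation])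

lemma coeff_monom_times_const_above: "i < m \<Longrightarrow> coeff (monom 1 i \<star> [:c:]) m = 0"
  unfolding monom_times by (rule coeff_T_mult_pow_eq_0) simp

lemma coeff_monom_times_const_top: "coeff (monom 1 i \<star> [:c:]) i = c"
  unfolding monom_times using coeff_T_mult_pow_top[of i "[:c:]"] by simp

lemma coeff_right_poly_eq_0: "n \<le> m \<Longrightarrow> coeff (right_poly n c) m = 0"
  by (simp add: right_poly_def coeff_sum coeff_monom_times_const_above)

lemma right_poly_Suc: "right_poly (Suc n) c = right_poly n c + monom 1 n \<star> [:c n:]"
  by (simp add: right_poly_def)

lemma right_poly_cong: "(\<And>i. i < n \<Longrightarrow> c i = d i) \<Longrightarrow> right_poly n c = right_poly n d"
  by (simp add: right_poly_def)

text \<open>Left and right coefficients of the highest power agree, so the top term can be split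
  off.\<close>

lemma right_poly_exists:
  "(\<And>m. n \<le> m \<Longrightarrow> coeff P m = 0) \<Longrightarrow> \<exists>c. P = right_poly n c"
proof (induction n arbitrary: P)
  case 0
  then show ?case by (auto simp: right_poly_def poly_eq_iff)
next
  case (Suc n)
  have "coeff (P - monom 1 n \<star> [:coeff P n:]) m = 0" if "n \<le> m" for m
    using that Suc.prems[of m] by (cases "m = n")
      (simp_all add: coeff_monom_times_const_above coeff_monom_times_const_top)
  from Suc.IH[OF this] obtain c where c: "P - monom 1 n \<star> [:coeff P n:] = right_poly n c" by blast
  have "right_poly n c = right_poly n (c(n := coeff P n))" by (rule right_poly_cong) simp
  then have "P = right_poly (Suc n) (c(n := coeff P n))"
    using c by (simp add: right_poly_Suc algebra_simps)
  then show ?case by blast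
qed

lemma coeff_right_poly_Suc_top: "coeff (right_poly (Suc n) c) n = c n"
  by (simp add: right_poly_Suc coeff_right_poly_eq_0 coeff_monom_times_const_top)

end

section \<open>Coordinates modulo a closed right ideal and the formal solution\<close>

context complete_differential_field
begin

lemma times_const_diff: "P \<star> [:a - b:] = P \<star> [:a:] - P \<star> [:b:]"
  by (simp flip: times_diff_right)

lemma right_poly_add: "right_poly n c + right_poly n d = right_poly n (\<lambda>i. c i + d i)"
  by (simp add: right_poly_def times_const_add sum.distrib)

lemma right_poly_times_const: "right_poly n c \<star> [:a:] = right_poly n (\<lambda>i. c i * a)"
  by (simp add: right_poly_def times_sum_left times_const_assoc)

text \<open>Adjoin \<open>1, T, ...\<close> to the closed ideal one power at a time; each step
  preserves closedness. Once all powers below \<open>T^n\<close> are in,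
  \<open>closed_subspace_coordinate_bound\<close> applies with \<open>b = T^n\<close>.\<close>

lemma closed_ideal_coordinate_bound:
  assumes s: "0 < s" "s < r" and L: "L \<noteq> 0" "degree L = Suc n"
    and closed: "norm_closed s (range (\<lambda>Q. L \<star> Q))"
  shows "\<exists>C>0. \<forall>Q c. v (c n) \<le> C * twisted_norm s (L \<star> Q + right_poly (Suc n) c)"
proof -
  define W where "W j = {L \<star> Q + right_poly j c |Q c. True}" for j
  have W_Suc: "W (Suc j) = {w + monom 1 j \<star> [:a:] |w a. w \<in> W j}" for j
  proof (intro equalityI subsetI)
    fix x assume "x \<in> W (Suc j)"
    then obtain Q c where "x = (L \<star> Q + right_poly j c) + monom 1 j \<star> [:c j:]"
      unfolding W_def right_poly_Suc add.assoc[symmetric] by blast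
    then show "x \<in> {w + monom 1 j \<star> [:a:] |w a. w \<in> W j}"
      unfolding W_def by blast
  next
    fix x assume "x \<in> {w + monom 1 j \<star> [:a:] |w a. w \<in> W j}"
    then obtain Q c a where x: "x = L \<star> Q + right_poly j c + monom 1 j \<star> [:a:]"
      unfolding W_def by blast
    have "right_poly j c = right_poly j (c(j := a))" by (rule right_poly_cong) simp
    then have "x = L \<star> Q + right_poly (Suc j) (c(j := a))"
      by (simp add: x right_poly_Suc)
    then show "x \<in> W (Suc j)" unfolding W_def by blast
  qed
  have sub: "right_subspace (W j)" for j
    unfolding right_subspace_def
  proof (intro conjI ballI allI)
    have "right_poly j (\<lambda>_. 0) = 0" by (simp add: right_poly_def times_0_right)
    then have "0 = L \<star> 0 + right_poly j (\<lambda>_. 0)" by (simp add: times_0_right)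
    then show "0 \<in> W j" unfolding W_def by blast
  next
    fix x y assume "x \<in> W j" "y \<in> W j"
    then obtain Q c Q' c' where "x = L \<star> Q + right_poly j c" "y = L \<star> Q' + right_poly j c'"
      unfolding W_def by blast
    then have "x + y = L \<star> (Q + Q') + right_poly j (\<lambda>i. c i + c' i)"
      by (simp add: twisted_simps flip: right_poly_add)
    then show "x + y \<in> W j" unfolding W_def by blast
  next
    fix x a assume "x \<in> W j"
    then obtain Q c where "x = L \<star> Q + right_poly j c" unfolding W_def by blast
    then have "x \<star> [:a:] = L \<star> (Q \<star> [:a:]) + right_poly j (\<lambda>i. c i * a)"
      by (simp add: twisted_simps times_assoc flip: right_poly_times_const)
    then show "x \<star> [:a:] \<in> W j" unfolding W_def by blast
  qed
  \<comment> \<open>A nonzero multiple of \<open>L\<close> has degree at least \<open>n + 1\<close>,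
    too large for a combination of \<open>1, ..., T^j\<close>.\<close>
  have notin: "monom 1 j \<notin> W j" if j: "j \<le> n" for j
  proof
    assume "monom 1 j \<in> W j"
    then obtain Q c where Q: "monom 1 j = L \<star> Q + right_poly j c" unfolding W_def by blast
    then have LQ: "L \<star> Q = monom 1 j - right_poly j c" by simp
    then have "coeff (L \<star> Q) j = 1" by (simp add: coeff_right_poly_eq_0)
    then have "Q \<noteq> 0" by (auto simp: times_0_right)
    then have "degree (L \<star> Q) \<ge> Suc n" using L by (simp add: degree_twisted_mult)
    moreover have "degree (L \<star> Q) \<le> j"
      unfolding LQ using j by (intro degree_le) (simp add: coeff_right_poly_eq_0)
    ultimately show False using j by simp
  qed
  have closed_W: "norm_closed s (W j)" if "j \<le> n" for j
    using that
  proof (induction j)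
    case 0
    have "W 0 = range (\<lambda>Q. L \<star> Q)" by (auto simp: W_def right_poly_def)
    then show ?case using closed by simp
  next
    case (Suc j)
    then show ?case
      unfolding W_Suc by (intro closed_subspace_extend s sub notin) simp_all
  qed
  obtain C where C: "C > 0" "\<And>w a. w \<in> W n \<Longrightarrow> v a \<le> C * twisted_norm s (w + monom 1 n \<star> [:a:])"
    using closed_subspace_coordinate_bound[OF s sub closed_W[OF order_refl] notin[OF order_refl]] by blast
  have "v (c n) \<le> C * twisted_norm s (L \<star> Q + right_poly (Suc n) c)" for Q c
  proof -
    have "L \<star> Q + right_poly n c \<in> W n" unfolding W_def by blast
    from C(2)[OF this, of "c n"] show ?thesis by (simp add: right_poly_Suc add.assoc)
  qed
  then show ?thesis using C(1) by blast
qed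

text \<open>\<open>remainder_coeff n l k\<close> lists the right coefficients of the remainder of \<open>T\<^sup>k\<close> modulo the right ideal
  generated by \<open>\<Sum>i\<le>n. T\<^sup>i l\<^sub>i\<close>.\<close>

primrec remainder_coeff :: "nat \<Rightarrow> (nat \<Rightarrow> 'k) \<Rightarrow> nat \<Rightarrow> nat \<Rightarrow> 'k" where
  "remainder_coeff n l 0 j = (if j = 0 then 1 else 0)"
| "remainder_coeff n l (Suc k) j = (if j = 0 then 0 else remainder_coeff n l k (j - 1))
     - D (remainder_coeff n l k j) - l j / l n * remainder_coeff n l k (n - 1)"

text \<open>Multiply the remainder of \<open>T^k\<close> by \<open>T\<close> on the right. Moving
  this \<open>T\<close> to the left of the coefficients produces the terms with \<open>D\<close>,
  and the resulting multiple of \<open>T^n\<close> is reduced by means of \<open>L\<close>.\<close>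

lemma monom_remainder:
  assumes L: "L = right_poly (Suc n) l" and "l n \<noteq> 0" "0 < n"
  shows "\<exists>Q. monom 1 k = L \<star> Q + right_poly n (remainder_coeff n l k)"
proof (induction k)
  case 0
  obtain m where "n = Suc m" using \<open>0 < n\<close> by (cases n) auto
  then have "right_poly n (remainder_coeff n l 0) = monom 1 0"
    by (simp add: right_poly_def sum.lessThan_Suc_shift times_0_right times_const_one del: sum.lessThan_Suc)
  then show ?case by (intro exI[of _ 0]) (simp add: times_0_right del: remainder_coeff.simps)
next
  case (Suc k)
  then obtain Q where Q: "monom 1 k = L \<star> Q + right_poly n (remainder_coeff n l k)" by blast
  define \<beta> where "\<beta> = remainder_coeff n l k"
  define e where "e i = (if i = 0 then 0 else \<beta> (i - 1))" for i
  have red: "remainder_coeff n l (Suc k) = (\<lambda>i. e i - D (\<beta> i) - l i / l n * \<beta> (n - 1))"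
    by (simp add: e_def \<beta>_def fun_eq_iff)
  let ?T = "[:0, 1:] :: 'k poly"
  have T: "?T = monom 1 1" by (simp add: monom_Suc)
  have "right_poly n \<beta> \<star> ?T = (\<Sum>i<n. monom 1 i \<star> (?T \<star> [:\<beta> i:] - [:D (\<beta> i):]))"
    unfolding right_poly_def times_sum_left times_assoc twisted_mult_T_const[OF derivation] by simp
  also have "\<dots> = (\<Sum>i<n. monom 1 (Suc i) \<star> [:\<beta> i:]) - (\<Sum>i<n. monom 1 i \<star> [:D (\<beta> i):])"
    unfolding times_diff_right sum_subtractf T times_assoc[symmetric] monom_times_monom by simp
  also have "(\<Sum>i<n. monom 1 (Suc i) \<star> [:\<beta> i:]) = right_poly (Suc n) e"
    unfolding right_poly_def sum.lessThan_Suc_shift by (simp add: e_def times_0_right)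
  also have "right_poly (Suc n) e = right_poly n e + monom 1 n \<star> [:\<beta> (n - 1):]"
    using \<open>0 < n\<close> by (simp add: right_poly_Suc e_def)
  also have "monom 1 n \<star> [:\<beta> (n - 1):] = (L - right_poly n l) \<star> [:\<beta> (n - 1) / l n:]"
    using \<open>l n \<noteq> 0\<close> by (simp add: L right_poly_Suc times_const_assoc)
  also have "\<dots> = L \<star> [:\<beta> (n - 1) / l n:] - right_poly n (\<lambda>i. l i / l n * \<beta> (n - 1))"
    by (simp add: times_diff_left right_poly_times_const)
  finally have "right_poly n \<beta> \<star> ?T = L \<star> [:\<beta> (n - 1) / l n:] + right_poly n (remainder_coeff n l (Suc k))"
    unfolding red by (simp add: right_poly_def times_const_diff sum_subtractf)
  moreover have "monom 1 (Suc k) = monom 1 k \<star> ?T"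
    by (simp add: T monom_times_monom)
  ultimately have "monom 1 (Suc k) = L \<star> (Q \<star> ?T + [:\<beta> (n - 1) / l n:]) + right_poly n (remainder_coeff n l (Suc k))"
    by (simp add: Q twisted_simps times_assoc \<beta>_def add.assoc)
  then show ?case by blast
qed

text \<open>The series \<open>\<Sum>k. taylor D (b k) * I\<^sup>k\<^sup>+\<^sup>1 g\<close>, whose \<open>k\<close>-th term only has coefficients of index
  above \<open>k\<close>.\<close>

definition volterra :: "(nat \<Rightarrow> 'k) \<Rightarrow> 'k fps \<Rightarrow> 'k fps" where
  "volterra b g = Abs_fps (\<lambda>m. \<Sum>k<m. (taylor D (b k) * (fps_integral0 ^^ Suc k) g) $ m)"

lemma integral_pow_nth:
  "(fps_integral0 ^^ k) g $ m = (if m < k then 0 else fact (m - k) / fact m * (g $ (m - k) :: 'k))"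
proof (induction k arbitrary: m)
  case (Suc k)
  show ?case
  proof (cases m)
    case (Suc m')
    then show ?thesis
      using Suc.IH[of m'] by (simp add: field_simps)
  qed simp
qed simp

lemma volterra_term_nth_eq_0:
  "m \<le> k \<Longrightarrow> (taylor D a * (fps_integral0 ^^ Suc k) g) $ m = 0"
  unfolding fps_mult_nth integral_pow_nth by (intro sum.neutral ballI) auto

text \<open>The terms with \<open>k \<ge> m\<close> vanish at index \<open>m\<close>, so sums for
  several indices can share one range.\<close>

lemma volterra_nth:
  assumes "m \<le> M"
  shows "volterra b g $ m = (\<Sum>k<M. (taylor D (b k) * (fps_integral0 ^^ Suc k) g) $ m)"
proof -
  have "(\<Sum>k<m. (taylor D (b k) * (fps_integral0 ^^ Suc k) g) $ m)
      = (\<Sum>k<M. (taylor D (b k) * (fps_integral0 ^^ Suc k) g) $ m)"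
    using assms by (intro sum.mono_neutral_left) (auto simp: volterra_term_nth_eq_0 simp del: funpow.simps)
  then show ?thesis by (simp add: volterra_def del: funpow.simps)
qed

lemma volterra_add: "volterra (\<lambda>k. b k + c k) g = volterra b g + volterra c g"
  by (rule fps_ext)
    (simp add: volterra_def taylor_add[OF derivation] distrib_right sum.distrib del: funpow.simps)

lemma volterra_times: "volterra (\<lambda>k. a * b k) g = taylor D a * volterra b g"
proof (rule fps_ext)
  fix m
  have "(taylor D a * volterra b g) $ m =
      (\<Sum>i=0..m. taylor D a $ i * (\<Sum>k<m. (taylor D (b k) * (fps_integral0 ^^ Suc k) g) $ (m - i)))"
    unfolding fps_mult_nth[of "taylor D a" "volterra b g"]
    by (intro sum.cong) (simp_all add: volterra_nth[of _ m] del: funpow.simps)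
  also have "\<dots> = (\<Sum>k<m. \<Sum>i=0..m. taylor D a $ i * (taylor D (b k) * (fps_integral0 ^^ Suc k) g) $ (m - i))"
    unfolding sum_distrib_left by (rule sum.swap)
  also have "\<dots> = (\<Sum>k<m. (taylor D a * (taylor D (b k) * (fps_integral0 ^^ Suc k) g)) $ m)"
    by (simp only: fps_mult_nth[of "taylor D a"])
  also have "\<dots> = volterra (\<lambda>k. a * b k) g $ m"
    by (simp add: volterra_def taylor_mult[OF derivation] mult.assoc del: funpow.simps)
  finally show "volterra (\<lambda>k. a * b k) g $ m = (taylor D a * volterra b g) $ m" ..
qed

text \<open>By the product rule, one part differentiates the Taylor series and gives
  \<open>D (b k)\<close>; the other removes one integration, and after splitting off
  \<open>k = 0\<close> its index is shifted.\<close>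

lemma volterra_deriv:
  "fps_deriv (volterra b g) = taylor D (b 0) * g + volterra (\<lambda>k. b (Suc k) + D (b k)) g"
proof (rule fps_ext)
  fix m
  let ?I = "\<lambda>k. (fps_integral0 ^^ k) g"
  have "fps_deriv (volterra b g) $ m = of_nat (m + 1) * (\<Sum>k<Suc m. (taylor D (b k) * ?I (Suc k)) $ (m + 1))"
    unfolding fps_deriv_nth by (subst volterra_nth[of "m + 1" "Suc m"]) simp_all
  also have "\<dots> = (\<Sum>k<Suc m. fps_deriv (taylor D (b k) * ?I (Suc k)) $ m)"
    by (simp only: fps_deriv_nth sum_distrib_left)
  also have "\<dots> = (\<Sum>k<Suc m. (taylor D (D (b k)) * ?I (Suc k)) $ m + (taylor D (b k) * ?I k) $ m)"
    by (simp add: fps_deriv_taylor[OF derivation] fps_deriv_fps_integral add.commute mult.commute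
        del: sum.lessThan_Suc)
  also have "\<dots> = volterra (\<lambda>k. D (b k)) g $ m + (\<Sum>k<Suc m. (taylor D (b k) * ?I k) $ m)"
    by (simp add: sum.distrib volterra_nth[of m "Suc m"] del: funpow.simps sum.lessThan_Suc)
  also have "(\<Sum>k<Suc m. (taylor D (b k) * ?I k) $ m) = (taylor D (b 0) * g) $ m + volterra (\<lambda>k. b (Suc k)) g $ m"
    by (simp add: sum.lessThan_Suc_shift volterra_def del: funpow.simps(2) sum.lessThan_Suc)
  finally show "fps_deriv (volterra b g) $ m =
      (taylor D (b 0) * g + volterra (\<lambda>k. b (Suc k) + D (b k)) g) $ m"
    by (simp add: volterra_add add_ac)
qed

lemma act_monom_times_const: "(monom 1 i \<star> [:c:]) \<triangleright> F = (fps_deriv ^^ i) (taylor D c * F)"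
proof -
  have "monom 1 i \<triangleright> G = (fps_deriv ^^ i) G" for G
  proof -
    have "monom 1 i \<triangleright> G = (\<Sum>j\<le>i. if j = i then (fps_deriv ^^ i) G else 0)"
      unfolding twisted_act_def degree_monom_eq[OF one_neq_zero]
      by (intro sum.cong) (auto simp: taylor_0[OF derivation] taylor_1[OF derivation])
    then show ?thesis by simp
  qed
  then show ?thesis
    by (simp add: twisted_act_twisted_mult[OF derivation] twisted_act_const[OF derivation])
qed

lemma higher_deriv_diff: "(fps_deriv ^^ i) (F - G) = (fps_deriv ^^ i) F - (fps_deriv ^^ i) (G :: 'k fps)"
  by (induction i) simp_all

text \<open>With \<open>f\<^sub>j = volterra (\<lambda>k. remainder_coeff n l k j) g\<close> the recursion for \<^const>\<open>remainder_coeff\<close> becomes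
  \<open>f\<^sub>j\<^sub>-\<^sub>1 = f\<^sub>j' + l\<^sub>j f\<close> up to the initial term \<open>g\<close>, and the sum of the derivatives telescopes.\<close>

lemma act_volterra_remainder:
  assumes "l n \<noteq> 0" "0 < n"
  shows "right_poly (Suc n) l \<triangleright> volterra (\<lambda>k. remainder_coeff n l k (n - 1) / l n) g = g"
proof -
  define f where "f = volterra (\<lambda>k. remainder_coeff n l k (n - 1) / l n) g"
  define F where "F j = volterra (\<lambda>k. remainder_coeff n l k j) g" for j
  \<comment> \<open>The \<open>j\<close>-th derivative of the \<open>j\<close>-th relation is
    \<open>h j - h (Suc j)\<close>, plus \<open>g\<close> for \<open>j = 0\<close>. The value
    \<open>h 0 = 0\<close> stands for the absent function of index -1.\<close>
  define h where "h i = (if i = 0 then 0 else (fps_deriv ^^ i) (F (i - 1)))" for i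
  have z: "volterra (\<lambda>k. 0) g = 0"
    using volterra_times[of 0 "\<lambda>k. 0" g] by (simp add: taylor_0[OF derivation])
  have top: "taylor D (l n) * f = F (n - 1)"
    using assms(1) by (simp add: f_def F_def flip: volterra_times)
  have step: "taylor D (l j) * f = (if j = 0 then 0 else F (j - 1)) + (if j = 0 then g else 0) - fps_deriv (F j)" for j
  proof -
    define X where "X = volterra (\<lambda>k. remainder_coeff n l (Suc k) j + D (remainder_coeff n l k j)) g"
    have "taylor D (l j) * f + X = volterra (\<lambda>k. if j = 0 then 0 else remainder_coeff n l k (j - 1)) g"
      unfolding f_def X_def volterra_times[symmetric] volterra_add[symmetric] by simp
    also have "\<dots> = (if j = 0 then 0 else F (j - 1))" by (simp add: F_def z)
    finally have "taylor D (l j) * f = (if j = 0 then 0 else F (j - 1)) - X" by (simp only: eq_diff_eq)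
    moreover have "fps_deriv (F j) = (if j = 0 then g else 0) + X"
      by (simp add: F_def X_def volterra_deriv taylor_0[OF derivation] taylor_1[OF derivation]
          del: remainder_coeff.simps(2))
    ultimately show ?thesis by simp
  qed
  have "(fps_deriv ^^ j) (taylor D (l j) * f) = h j - h (Suc j) + (if j = 0 then g else 0)" for j
    unfolding step
    by (cases "j = 0") (simp_all add: h_def higher_deriv_diff funpow_swap1)
  moreover have "(fps_deriv ^^ n) (taylor D (l n) * f) = h n"
    unfolding top using assms(2) by (simp add: h_def)
  ultimately have "right_poly (Suc n) l \<triangleright> f = (\<Sum>j<n. h j - h (Suc j) + (if j = 0 then g else 0)) + h n"
    by (simp add: right_poly_def act_sum_left act_monom_times_const twisted_act_add_left[OF derivation])
  also have "\<dots> = (h 0 - h n) + g + h n"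
    using assms(2) by (simp add: sum.distrib sum_lessThan_telescope' sum.delta)
  finally show ?thesis by (simp add: f_def h_def)
qed

end

section \<open>Convergence of the formal solution and surjectivity of nonzero operators\<close>

lemma bounded_power_times_poly:
  fixes x :: real
  assumes "0 \<le> x" "x < 1"
  shows "\<exists>A. \<forall>n. x ^ n * real (n + 1) ^ k \<le> A"
  using assms
proof (induction k arbitrary: x)
  case 0
  then show ?case by (intro exI[of _ 1]) (simp add: power_le_one)
next
  case (Suc k)
  \<comment> \<open>Writing \<open>x\<close> as a square leaves one factor \<open>y ^ n\<close> to
    absorb the additional power of \<open>n + 1\<close>.\<close>
  define y where "y = sqrt x"
  have y: "0 \<le> y" "y < 1" "x = y * y" using Suc.prems by (simp_all add: y_def)
  obtain A where A: "\<And>n. y ^ n * real (n + 1) ^ k \<le> A" using Suc.IH[OF y(1,2)] by blast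
  have "(\<lambda>n. real n * y ^ n + y ^ n) \<longlonglongrightarrow> 0 + 0"
    using y by (intro tendsto_add powser_times_n_limit_0 LIMSEQ_power_zero) simp_all
  then have "Bseq (\<lambda>n. real n * y ^ n + y ^ n)" by (intro convergent_imp_Bseq convergentI)
  then obtain B where B: "\<And>n. norm (real n * y ^ n + y ^ n) \<le> B" by (auto simp: Bseq_def)
  have "x ^ n * real (n + 1) ^ Suc k \<le> A * B" for n
  proof -
    have "x ^ n * real (n + 1) ^ Suc k = (y ^ n * real (n + 1) ^ k) * (real n * y ^ n + y ^ n)"
      by (simp add: y(3) power_mult_distrib algebra_simps)
    also have "\<dots> \<le> A * B"
      using A[of n] B[of n] y(1) order_trans[OF _ A[of n], of 0] by (intro mult_mono) auto
    finally show ?thesis .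
  qed
  then show ?case by blast
qed

context complete_differential_field
begin

text \<open>Up to polynomial growth, \<open>k + 1\<close> integrations cost a factor
  \<open>t ^ k / v (fact k)\<close>, which cancels against the bound on \<open>b k\<close>. The
  radius \<open>t\<close> between \<open>s\<close> and \<open>r\<close> provides a power of
  \<open>s / t\<close> that absorbs the polynomial.\<close>

lemma volterra_convergent:
  assumes b: "\<And>t. 0 < t \<Longrightarrow> t < r \<Longrightarrow> \<exists>C. \<forall>k. v (b k) \<le> C * (v (fact k) / t ^ k)"
    and g: "g \<in> convergent_series v r"
  shows "volterra b g \<in> convergent_series v r"
  unfolding convergent_series_iff
proof (intro allI impI, elim conjE)
  fix s assume s: "0 < s" "s < r"
  define t where "t = (s + r) / 2"
  have t: "s < t" "t < r" "0 < t" using s by (simp_all add: t_def)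
  obtain C where C: "\<And>k. v (b k) \<le> C * (v (fact k) / t ^ k)" using b[OF t(3,2)] by blast
  obtain G where G: "gauss_le t g G" using g t by (auto simp: convergent_series_iff)
  obtain \<kappa> where \<kappa>: "\<And>k m. v (fact k * fact m / fact (m + k + 1)) \<le> real (m + k + 1) ^ \<kappa>"
    using v_harmonic_triangle by blast
  obtain A where A: "\<And>n. (s / t) ^ n * real (n + 1) ^ \<kappa> \<le> A"
    using bounded_power_times_poly[of "s / t"] s t by auto
  have G0: "0 \<le> G" using gauss_le_nonneg G by blast
  have A0: "0 \<le> A" using A[of 0] by simp
  have int_le: "gauss_le s ((fps_integral0 ^^ Suc k) g) (t ^ k / v (fact k) * (G * s * A))" for k
    unfolding gauss_le_def
  proof
    fix i
    have nn: "0 \<le> t ^ k / v (fact k) * (G * s * A)" using G0 A0 s t by simp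
    show "v ((fps_integral0 ^^ Suc k) g $ i) * s ^ i \<le> t ^ k / v (fact k) * (G * s * A)"
    proof (cases "i < Suc k")
      case True
      then show ?thesis using nn by (simp add: integral_pow_nth del: funpow.simps)
    next
      case False
      define m where "m = i - Suc k"
      have i: "i = m + k + 1" using False by (simp add: m_def)
      have fk: "v (fact k) > 0" by (intro v_pos) simp
      have "v ((fps_integral0 ^^ Suc k) g $ i) = v (fact m / fact (m + k + 1)) * v (g $ m)"
        using False unfolding integral_pow_nth by (simp add: i v_mult v_divide del: fact_Suc)
      \<comment> \<open>Expanding the fraction by \<open>k!\<close> brings in the harmonic
        triangle.\<close>
      also have "v (fact m / fact (m + k + 1)) = v (fact k * fact m / fact (m + k + 1)) / v (fact k)"
        using fk by (simp add: v_mult v_divide del: fact_Suc)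
      also have "\<dots> * v (g $ m) \<le> real (m + k + 1) ^ \<kappa> / v (fact k) * (G / t ^ m)"
      proof (intro mult_mono divide_right_mono \<kappa>)
        show "v (g $ m) \<le> G / t ^ m" using G t by (simp add: gauss_le_def pos_le_divide_eq)
      qed (use fk in simp_all)
      finally have "v ((fps_integral0 ^^ Suc k) g $ i) * s ^ i \<le>
          real (m + k + 1) ^ \<kappa> / v (fact k) * (G / t ^ m) * s ^ i"
        using s by (intro mult_right_mono) simp_all
      \<comment> \<open>Since \<open>i = m + k + 1\<close>, one factor \<open>s\<close> remains
        beside \<open>(s / t) ^ (m + k)\<close>.\<close>
      also have "\<dots> = t ^ k / v (fact k) * (G * s * ((s / t) ^ (m + k) * real (m + k + 1) ^ \<kappa>))"
        using t by (simp add: i power_add power_divide)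
      also have "\<dots> \<le> t ^ k / v (fact k) * (G * s * A)"
        using A[of "m + k"] G0 s t by (intro mult_left_mono) simp_all
      finally show ?thesis .
    qed
  qed
  have term_le: "gauss_le s (taylor D (b k) * (fps_integral0 ^^ Suc k) g) (C * (G * s * A))" for k
  proof -
    have fk: "v (fact k) > 0" by (intro v_pos) simp
    have "gauss_le s (taylor D (b k) * (fps_integral0 ^^ Suc k) g)
        (v (b k) * (t ^ k / v (fact k) * (G * s * A)))"
      by (intro gauss_le_mult gauss_le_taylor s int_le)
    moreover have "v (b k) * (t ^ k / v (fact k) * (G * s * A)) \<le>
        C * (v (fact k) / t ^ k) * (t ^ k / v (fact k) * (G * s * A))"
      using C[of k] G0 A0 s t by (intro mult_right_mono) simp_all
    then have "v (b k) * (t ^ k / v (fact k) * (G * s * A)) \<le> C * (G * s * A)"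
      using fk t by simp
    ultimately show ?thesis by (rule gauss_le_mono)
  qed
  have C0: "0 \<le> C * (G * s * A)" using gauss_le_nonneg term_le by blast
  have "gauss_le s (volterra b g) (C * (G * s * A))"
    unfolding gauss_le_def
  proof
    fix i
    have "v (volterra b g $ i) \<le> C * (G * s * A) / s ^ i"
      unfolding volterra_nth[OF order_refl]
    proof (rule v_sum_le)
      fix k
      show "v ((taylor D (b k) * (fps_integral0 ^^ Suc k) g) $ i) \<le> C * (G * s * A) / s ^ i"
        using term_le[of k] s by (simp add: gauss_le_def pos_le_divide_eq del: funpow.simps)
    qed (use C0 s in simp)
    then show "v (volterra b g $ i) * s ^ i \<le> C * (G * s * A)" using s by (simp add: pos_le_divide_eq)
  qed
  then show "\<exists>B. gauss_le s (volterra b g) B" ..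
qed

lemma solvable:
  assumes "L \<noteq> 0" "g \<in> convergent_series v r"
  shows "\<exists>f\<in>convergent_series v r. L \<triangleright> f = g"
  using assms
proof (induction "degree L" arbitrary: L g rule: less_induct)
  case less
  note L = \<open>L \<noteq> 0\<close> and g = less.prems(2)
  \<comment> \<open>The third case is the negation of the first two; the induction hypothesis serves
    the second.\<close>
  consider
      (invertible) s Q where "0 < s" "s < r" "twisted_norm s (1 - L \<star> Q) < 1"
    | (factor) M N where "L = M \<star> N" "degree M < degree L" "degree N < degree L"
    | (irreducible) "\<And>s Q. 0 < s \<Longrightarrow> s < r \<Longrightarrow> 1 \<le> twisted_norm s (1 - L \<star> Q)"
        "\<And>M N. L = M \<star> N \<Longrightarrow> degree M < degree L \<Longrightarrow> \<not> degree N < degree L"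
    by (meson not_less)
  then show ?case
  proof cases
    case invertible
    then show ?thesis using solvable_if_right_invertible g by blast
  next
    case factor
    then have "M \<noteq> 0" "N \<noteq> 0" using L by (auto simp: times_0_right twisted_simps)
    then obtain f where f: "f \<in> convergent_series v r" "M \<triangleright> f = g"
      using less.hyps[OF factor(2)] g by blast
    obtain f' where "f' \<in> convergent_series v r" "N \<triangleright> f' = f"
      using less.hyps[OF factor(3) \<open>N \<noteq> 0\<close> f(1)] by blast
    then show ?thesis
      using f by (intro bexI[of _ f']) (simp_all add: factor twisted_act_twisted_mult[OF derivation])
  next
    case irreducible
    have closed: "norm_closed s (range (\<lambda>Q. L \<star> Q))" if s: "0 < s" "s < r" for s
    proof -
      \<comment> \<open>The closure of the right ideal generated by \<open>L\<close>.
        Submultiplicativity of the norm makes it a right ideal, hence principal.\<close>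
      define J where "J = {x. \<forall>\<epsilon>>0. \<exists>Q. twisted_norm s (x - L \<star> Q) < \<epsilon>}"
      have LJ: "L \<star> Q \<in> J" for Q
        unfolding J_def by (auto intro!: exI[of _ Q] simp: twisted_norm_def)
      have "\<exists>B\<in>J. \<forall>P\<in>J. \<exists>Q. P = B \<star> Q"
      proof (rule right_ideal_principal)
        show "0 \<in> J" using LJ[of 0] by (simp add: times_0_right)
      next
        fix x y assume xy: "x \<in> J" "y \<in> J"
        show "x + y \<in> J"
          unfolding J_def
        proof (intro CollectI allI impI)
          fix \<epsilon> :: real assume "\<epsilon> > 0"
          then obtain Q Q' where "twisted_norm s (x - L \<star> Q) < \<epsilon>" "twisted_norm s (y - L \<star> Q') < \<epsilon>"
            using xy unfolding J_def by blast
          then have "twisted_norm s ((x - L \<star> Q) + (y - L \<star> Q')) < \<epsilon>"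
            using twisted_norm_add[OF s(1), of "x - L \<star> Q" "y - L \<star> Q'"] by linarith
          then show "\<exists>Q. twisted_norm s (x + y - L \<star> Q) < \<epsilon>"
            by (intro exI[of _ "Q + Q'"]) (simp add: twisted_simps algebra_simps)
        qed
      next
        fix x P assume x: "x \<in> J"
        show "x \<star> P \<in> J"
          unfolding J_def
        proof (intro CollectI allI impI)
          fix \<epsilon> :: real assume "\<epsilon> > 0"
          define N where "N = twisted_norm s P + 1"
          have N: "0 < N" "twisted_norm s P \<le> N"
            using twisted_norm_nonneg[OF s(1), of P] by (simp_all add: N_def)
          then have "0 < \<epsilon> / N" using \<open>\<epsilon> > 0\<close> by (intro divide_pos_pos)
          then obtain Q where Q: "twisted_norm s (x - L \<star> Q) < \<epsilon> / N"
            using x unfolding J_def by blast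
          have "twisted_norm s (x \<star> P - L \<star> (Q \<star> P)) = twisted_norm s ((x - L \<star> Q) \<star> P)"
            by (simp add: times_diff_left times_assoc)
          also have "\<dots> \<le> twisted_norm s (x - L \<star> Q) * twisted_norm s P"
            by (rule twisted_norm_mult[OF s])
          also have "\<dots> \<le> twisted_norm s (x - L \<star> Q) * N"
            using N twisted_norm_nonneg[OF s(1)] by (intro mult_left_mono)
          also have "\<dots> < \<epsilon>" using Q N(1) by (simp add: pos_less_divide_eq)
          finally show "\<exists>Q. twisted_norm s (x \<star> P - L \<star> Q) < \<epsilon>" by blast
        qed
      qed
      then obtain M where M: "M \<in> J" "\<And>P. P \<in> J \<Longrightarrow> \<exists>Q. P = M \<star> Q" by blast
      obtain N where N: "L = M \<star> N" using M(2)[OF LJ[of 1]] by (auto simp: twisted_simps)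
      have MN0: "M \<noteq> 0" "N \<noteq> 0" using N L by (auto simp: times_0_right twisted_simps)
      \<comment> \<open>A constant generator would put some \<open>L \<star> Q\<close> close to a
        unit, and rescaling by \<open>[:1 / c:]\<close> would lead to the invertible case.\<close>
      have "degree M \<noteq> 0"
      proof
        assume "degree M = 0"
        then obtain c where c: "M = [:c:]" "c \<noteq> 0" using MN0 by (metis degree_eq_zeroE pCons_0_0)
        have "M \<star> [:1 / c:] = 1" using c by (simp add: const_times_const one_pCons)
        obtain Q where Q: "twisted_norm s (M - L \<star> Q) < v c"
          using M(1) v_pos[OF c(2)] unfolding J_def by blast
        have "1 - L \<star> (Q \<star> [:1 / c:]) = (M - L \<star> Q) \<star> [:1 / c:]"
          using \<open>M \<star> [:1 / c:] = 1\<close> by (simp add: times_diff_left times_assoc)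
        then have "twisted_norm s (1 - L \<star> (Q \<star> [:1 / c:])) \<le> twisted_norm s (M - L \<star> Q) * v (1 / c)"
          using twisted_norm_times_const[OF s] by simp
        also have "\<dots> < 1" using Q v_pos[OF c(2)] by (simp add: v_divide)
        finally show False using irreducible(1)[OF s] by (simp add: not_less[symmetric])
      qed
      moreover have "degree L = degree M + degree N"
        unfolding N using MN0 by (rule degree_twisted_mult)
      \<comment> \<open>As \<open>M\<close> is not constant, \<open>N\<close> has smaller degree
        than \<open>L\<close>; irreducibility then forces \<open>M\<close> to have the degree of
        \<open>L\<close>.\<close>
      ultimately have "degree N = 0" using irreducible(2)[OF N] by linarith
      then obtain c where c: "N = [:c:]" "c \<noteq> 0" using MN0 by (metis degree_eq_zeroE pCons_0_0)
      then have "M = L \<star> [:1 / c:]" by (simp add: N times_const_assoc times_const_one)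
      then have "P \<in> range (\<lambda>Q. L \<star> Q)" if "P \<in> J" for P
        using M(2)[OF that] by (auto simp: times_assoc)
      then show ?thesis unfolding norm_closed_def J_def by auto
    qed
    \<comment> \<open>A nonzero constant is a unit and belongs to the invertible case at every
      radius, for instance \<open>r / 2\<close>.\<close>
    have "degree L \<noteq> 0"
    proof
      assume "degree L = 0"
      then obtain c where c: "L = [:c:]" "c \<noteq> 0" using L by (metis degree_eq_zeroE pCons_0_0)
      then have "L \<star> [:1 / c:] = 1" by (simp add: const_times_const one_pCons)
      then show False
        using irreducible(1)[of "r / 2" "[:1 / c:]"] r_pos by (simp add: twisted_norm_def)
    qed
    then obtain n where n: "degree L = Suc n" by (cases "degree L") auto
    obtain l where l: "L = right_poly (Suc (Suc n)) l"
      using right_poly_exists[of "Suc (Suc n)" L] n by (auto simp: coeff_eq_0)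
    have "l (Suc n) = lead_coeff L"
      unfolding n unfolding l by (simp only: coeff_right_poly_Suc_top)
    then have l0: "l (Suc n) \<noteq> 0" using L by simp
    \<comment> \<open>Remainders modulo \<open>L\<close> have \<open>n + 1\<close> right
      coefficients, the last of index \<open>n\<close>, while \<open>l (Suc n)\<close> is the
      leading coefficient of \<open>L\<close>.\<close>
    define b where "b k = remainder_coeff (Suc n) l k n / l (Suc n)" for k
    have "volterra b g \<in> convergent_series v r"
    proof (rule volterra_convergent[OF _ g])
      fix t assume t: "0 < t" "t < r"
      obtain C where C: "C > 0" "\<And>Q c. v (c n) \<le> C * twisted_norm t (L \<star> Q + right_poly (Suc n) c)"
        using closed_ideal_coordinate_bound[OF t L n closed[OF t]] by blast
      have "v (b k) \<le> C / v (l (Suc n)) * (v (fact k) / t ^ k)" for k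
      proof -
        obtain Q where "monom 1 k = L \<star> Q + right_poly (Suc n) (remainder_coeff (Suc n) l k)"
          using monom_remainder[OF l l0] by blast
        \<comment> \<open>The multiple of \<open>L\<close> and the remainder add up to
          \<open>T^k\<close>, so the coordinate is controlled by the norm of \<open>T^k\<close>
          alone.\<close>
        then have "v (remainder_coeff (Suc n) l k n) \<le> C * twisted_norm t (monom 1 k)"
          using C(2)[of "remainder_coeff (Suc n) l k" Q] by simp
        also have "\<dots> \<le> C * (v (fact k) / t ^ k)"
          using C(1) twisted_norm_monom[OF t(1)] by (intro mult_left_mono) simp_all
        finally have "v (remainder_coeff (Suc n) l k n) / v (l (Suc n)) \<le> C * (v (fact k) / t ^ k) / v (l (Suc n))"
          by (intro divide_right_mono) simp_all
        then show ?thesis by (simp add: b_def v_divide mult.commute)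
      qed
      then show "\<exists>C. \<forall>k. v (b k) \<le> C * (v (fact k) / t ^ k)" by blast
    qed
    moreover have "L \<triangleright> volterra b g = g"
      using act_volterra_remainder[of l "Suc n" g] l0 by (simp add: l b_def[abs_def])
    ultimately show ?thesis by blast
  qed
qed

end

theorem theorem5p6:
  fixes v :: "'k::field_char_0 \<Rightarrow> real" and D :: "'k \<Rightarrow> 'k" and r :: real
  assumes "nonarch_abs v" and "nontrivial_abs v" and "complete_abs v"
    and "derivation D" and "bounded_op v D" and "\<exists>x. D x \<noteq> 0"
    and "residue_char v > 0"
    and "0 < r" and "ereal r \<le> derivation_radius v D"
  shows "injective_left_module TYPE('m) TYPE('n)
           (twisted_poly_ring D) (convergent_series_module v D r)"
proof -
  interpret complete_differential_field v D r
    by unfold_locales (use assms in auto)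
  show ?thesis
  proof (rule injective_if_divisible[OF left_module_convergent_series])
    fix P :: "'k poly" and y :: "'k fps"
    assume "P \<noteq> 0" "y \<in> carrier (convergent_series_module v D r)"
    then show "\<exists>x\<in>carrier (convergent_series_module v D r).
        P \<odot>\<^bsub>convergent_series_module v D r\<^esub> x = y"
      using solvable by (simp add: convergent_series_module_def power_series_module_def)
  qed
qed

end
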